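(* Let $(p,q)\in(0,1)^2$ with $p+q<1$, let $L:\mathbb{R}^2\to\mathbb{R}$ be the next-token prediction loss (with optimal bias) defined in the context, and let $(\theta_t)_{t\ge0}$ be the gradient flow trajectory of $L$ starting from $\theta_0$. Then for any initialization $\theta_0\in\mathbb{R}^2$ the trajectory converges to some $\theta_{\lim}\in\mathbb{R}^2$ which is a critical point of $L$. Write $\mathcal{E}_{\mathrm{sad}}=-(1+\log2)/2$ and $g(w)=\sqrt{w^2-\log(-w)+\mathcal{E}_{\mathrm{sad}}}$ for $w<0$. More specifically, $\theta_{\lim}$ is (i) a local minimum (that is not a global minimum) if $\theta_0\in\mathcal{I}_{\min}:=\{(e,w): w<-1/\sqrt2,\ e\in(-g(w),g(w))\}$; (ii) a saddle point if $\theta_0\in\mathcal{I}_{\mathrm{sad}}:=\{(e,w): w\le-1/\sqrt2,\ e=\pm g(w)\}$; (iii) a local maximum if $\theta_0\in\mathcal{I}_{\max}:=\{(e,w): e=0,\ w>-1/\sqrt2\}$; (iv) a global minimum if $\theta_0\in\mathbb{R}^2\setminus(\mathcal{I}_{\min}\cup\mathcal{I}_{\mathrm{sad}}\cup\mathcal{I}_{\max})$. Consequently, if $\theta_0\sim\mathcal{N}(0,\sigma^2I_2)$, the probability that $\theta_{\lim}$ is a global minimum tends to $1$ as $\sigma\to0$.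
   Context: Data. $(x_n)_{n\ge1}$ is a $\{0,1\}$-valued time-homogeneous first-order Markov chain with $\mathbb{P}(x_{n+1}=1\mid x_n=0)=p$, $\mathbb{P}(x_{n+1}=0\mid x_n=1)=q$, started from its stationary law $\pi=(\pi_0,\pi_1)=(q,p)/(p+q)$; $N\in\mathbb{N}$ is the sequence length. Loss. Let $\ell_{\log}(z)=\log(1+e^{-z})$. For $\theta=(e,w)\in\mathbb{R}^2$ and $b\in\mathbb{R}$ (here $e$ is a real parameter), $$L(\theta,b)=\frac1N\sum_{n=1}^N\mathbb{E}\Big[\ell_{\log}\Big((2x_{n+1}-1)\big(e^2(1+2w|w|)x_n+b-\tfrac{e^2}{2}\big)\Big)\Big],$$ and $L(\theta)=L(\theta,b_\star(\theta))$ with $b_\star(\theta)=\arg\min_{b\in\mathbb{R}}L(\theta,b)$. Gradient flow. $(\theta_t)_{t\ge0}$, $\theta_t=(e_t,w_t)$, is the $C^1$ curve in $\mathbb{R}^2$ with $\frac{d\theta_t}{dt}=-\nabla L(\theta_t)$ and initial value $\theta_0$. Terminology. $\theta$ is a critical point if $\nabla L(\theta)=0$. A critical point $\theta_*$ is a local minimum (maximum) if $L(\theta_* )\le L(\theta)$ (resp. $\ge$) for all $\theta$ in some neighborhood of $\theta_*$; a global minimum if the inequality holds on all of $\mathbb{R}^2$; a saddle point if every neighborhood $U$ of it contains $\theta_1,\theta_2\in U$ with $L(\theta_1)<L(\theta_* )<L(\theta_2)$. *)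

theory Defs
  imports "HOL-Probability.Probability"
begin

section \<open>The data\<close>

text \<open>
  The chain is indexed by \<open>n \<ge> 1\<close>; \<open>x 0\<close> is unconstrained and never used.
  The initial law is the stationary law \<open>(q, p) / (p + q)\<close>.
\<close>

locale binary_markov_chain = prob_space M for M :: "'w measure" +
  fixes x :: "nat \<Rightarrow> 'w \<Rightarrow> nat" and p q :: real
  assumes random_variable_x: "\<And>n. n \<ge> 1 \<Longrightarrow> x n \<in> measurable M (count_space {0, 1})"
    and initial_0: "\<P>(\<omega> in M. x 1 \<omega> = 0) = q / (p + q)"
    and initial_1: "\<P>(\<omega> in M. x 1 \<omega> = 1) = p / (p + q)"
    and markov: "\<And>n s j. n \<ge> 1 \<Longrightarrow> \<P>(\<omega> in M. \<forall>k\<in>{1..n}. x k \<omega> = s k) > 0 \<Longrightarrow>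
      \<P>(\<omega> in M. x (n + 1) \<omega> = j \<bar> \<forall>k\<in>{1..n}. x k \<omega> = s k)
        = \<P>(\<omega> in M. x (n + 1) \<omega> = j \<bar> x n \<omega> = s n)"
    and transition_01: "\<And>n. n \<ge> 1 \<Longrightarrow> \<P>(\<omega> in M. x (n + 1) \<omega> = 1 \<bar> x n \<omega> = 0) = p"
    and transition_10: "\<And>n. n \<ge> 1 \<Longrightarrow> \<P>(\<omega> in M. x (n + 1) \<omega> = 0 \<bar> x n \<omega> = 1) = q"


section \<open>The loss\<close>

definition logistic_loss :: "real \<Rightarrow> real" where
  "logistic_loss z = ln (1 + exp (- z))"

definition bias_loss ::
  "'w measure \<Rightarrow> (nat \<Rightarrow> 'w \<Rightarrow> nat) \<Rightarrow> nat \<Rightarrow> real \<times> real \<Rightarrow> real \<Rightarrow> real" where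
  "bias_loss M x N = (\<lambda>(e, w) b.
     1 / real N * (\<Sum>n=1..N. \<integral>\<omega>. logistic_loss ((2 * real (x (n + 1) \<omega>) - 1) *
       (e\<^sup>2 * (1 + 2 * w * \<bar>w\<bar>) * real (x n \<omega>) + b - e\<^sup>2 / 2)) \<partial>M))"

definition optimal_bias ::
  "'w measure \<Rightarrow> (nat \<Rightarrow> 'w \<Rightarrow> nat) \<Rightarrow> nat \<Rightarrow> real \<times> real \<Rightarrow> real" where
  "optimal_bias M x N \<theta> = (ARG_MIN (bias_loss M x N \<theta>) b. True)"

definition loss ::
  "'w measure \<Rightarrow> (nat \<Rightarrow> 'w \<Rightarrow> nat) \<Rightarrow> nat \<Rightarrow> real \<times> real \<Rightarrow> real" where
  "loss M x N \<theta> = bias_loss M x N \<theta> (optimal_bias M x N \<theta>)"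


section \<open>Critical points and gradient flow\<close>

text \<open>Only meaningful where \<open>f\<close> is differentiable.\<close>

definition gradient :: "('a::real_inner \<Rightarrow> real) \<Rightarrow> 'a \<Rightarrow> 'a" where
  "gradient f x = (THE D. GDERIV f x :> D)"

definition critical_point :: "('a::real_inner \<Rightarrow> real) \<Rightarrow> 'a \<Rightarrow> bool" where
  "critical_point f x \<longleftrightarrow> GDERIV f x :> 0"

definition local_minimum :: "('a::real_inner \<Rightarrow> real) \<Rightarrow> 'a \<Rightarrow> bool" where
  "local_minimum f x \<longleftrightarrow> critical_point f x \<and> (\<forall>\<^sub>F y in nhds x. f x \<le> f y)"

definition local_maximum :: "('a::real_inner \<Rightarrow> real) \<Rightarrow> 'a \<Rightarrow> bool" where
  "local_maximum f x \<longleftrightarrow> critical_point f x \<and> (\<forall>\<^sub>F y in nhds x. f x \<ge> f y)"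

definition global_minimum :: "('a::real_inner \<Rightarrow> real) \<Rightarrow> 'a \<Rightarrow> bool" where
  "global_minimum f x \<longleftrightarrow> critical_point f x \<and> (\<forall>y. f x \<le> f y)"

definition saddle_point :: "('a::real_inner \<Rightarrow> real) \<Rightarrow> 'a \<Rightarrow> bool" where
  "saddle_point f x \<longleftrightarrow> critical_point f x \<and>
     (\<forall>U. open U \<and> x \<in> U \<longrightarrow> (\<exists>y\<in>U. \<exists>z\<in>U. f y < f x \<and> f x < f z))"

text \<open>
  Trajectories are functions on \<^typ>\<open>real\<close> of which only the restriction to \<open>t \<ge> 0\<close> matters;
  at \<open>t = 0\<close> the derivative is one-sided. The last conjunct says that the curve is \<open>C\<^sup>1\<close>.
\<close>

definition gradient_flow ::
  "('a::real_inner \<Rightarrow> real) \<Rightarrow> 'a \<Rightarrow> (real \<Rightarrow> 'a) \<Rightarrow> bool" where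
  "gradient_flow f \<theta>0 \<theta> \<longleftrightarrow> \<theta> 0 = \<theta>0 \<and>
     (\<forall>t\<ge>0. (\<theta> has_vector_derivative - gradient f (\<theta> t)) (at t within {0..})) \<and>
     continuous_on {0..} (\<lambda>t. gradient f (\<theta> t))"


section \<open>Regions of initializations\<close>

definition E_sad :: real where
  "E_sad = - (1 + ln 2) / 2"

definition g :: "real \<Rightarrow> real" where
  "g w = sqrt (w\<^sup>2 - ln (- w) + E_sad)"

definition I_min :: "(real \<times> real) set" where
  "I_min = {(e, w). w < - 1 / sqrt 2 \<and> e \<in> {- g w<..<g w}}"

definition I_sad :: "(real \<times> real) set" where
  "I_sad = {(e, w). w \<le> - 1 / sqrt 2 \<and> (e = g w \<or> e = - g w)}"

definition I_max :: "(real \<times> real) set" where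
  "I_max = {(e, w). e = 0 \<and> w > - 1 / sqrt 2}"


section \<open>Gaussian initialization\<close>

text \<open>The law \<open>N(0, \<sigma>\<^sup>2 I\<^sub>2)\<close>; the second parameter of \<^const>\<open>normal_density\<close> is the standard deviation.\<close>

definition isotropic_normal :: "real \<Rightarrow> (real \<times> real) measure" where
  "isotropic_normal \<sigma> =
     density lborel (normal_density 0 \<sigma>) \<Otimes>\<^sub>M density lborel (normal_density 0 \<sigma>)"

end

theory Submission
  imports Defs
begin

text \<open>
  By stationarity the loss depends on \<open>(e, w)\<close> only through the signal \<open>a = e\<^sup>2 (1 + 2 w \<bar>w\<bar>)\<close>, and the
  minimum over the bias is explicit. As a function of \<open>a\<close> it strictly decreases up to some \<open>a\<^sub>* > 0\<close>
  and strictly increases afterwards, so the critical points are the line \<open>e = 0\<close> and the curve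
  \<open>a = a\<^sub>*\<close>, which consists of global minima. Along the flow \<open>a\<close> never crosses \<open>a\<^sub>*\<close>; hence \<open>w\<close> is
  monotone, \<open>e\<^sup>2\<close> is eventually monotone, and both are bounded, which gives convergence. The type of
  the limit is read off the quantity \<open>e\<^sup>2 - (w\<^sup>2 - ln (- w))\<close>, which is conserved as long as
  \<open>w < 0\<close>. Global existence follows from Picard iteration for a truncated field, since the orbit
  bounds do not depend on the speed along the orbit.
\<close>

section \<open>Flows of bounded Lipschitz fields\<close>

text \<open>The conserved quantity comes from dividing the two flow equations: d(e^2)/dw = (1 + 2 w
  |w|) / |w|, which for w < 0 equals 2 w - 1/w and integrates to w^2 - ln (- w). The constant
  \<open>E_sad\<close> normalises it: w^2 - ln (- w) has its minimum over w < 0 at w = -1/sqrt 2,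
  with value - \<open>E_sad\<close>. There the factor 1 + 2 w |w| changes sign, so this is the
  threshold between decrease and growth of e^2. At the threshold the normalised energy e^2 - (w^2 -
  ln (- w) + \<open>E_sad\<close>) is just e^2. An orbit coming from the left therefore cannot reach
  it with negative energy, could reach it only at an equilibrium with zero energy, and is not
  trapped at e = 0 with positive energy; these are the three fates on the left. The obstacle to
  convergence is that critical points are not isolated: they fill the line e = 0 and a curve, so
  boundedness of the orbit and decrease of the loss alone would not single out a limit
  point.\<close>

lemma integral_has_vector_derivative_atLeast:
  fixes h :: "real \<Rightarrow> 'a::banach"
  assumes "continuous_on {0..} h" and "t \<ge> 0"
  shows "((\<lambda>u. integral {0..u} h) has_vector_derivative h t) (at t within {0..})"
proof -
  have "continuous_on {0..t + 1} h"
    using assms(1) by (rule continuous_on_subset) auto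
  then have "((\<lambda>u. integral {0..u} h) has_vector_derivative h t) (at t within {0..t + 1})"
    using assms(2) by (intro integral_has_vector_derivative) auto
  moreover have "at t within {0..} = at t within {0..t + 1}"
    by (rule at_within_nhd[where S = "{..<t + 1}"]) (use assms(2) in auto)
  ultimately show ?thesis
    by simp
qed

text \<open>Picard iteration on the whole half-line at once, for the rescaled unknown y(t) = exp (-
  c t) \<theta>(t). The weight makes the operator a contraction without restricting time, and the
  bound B on the field makes \<theta> grow at most linearly, so y is a bounded continuous
  function.\<close>

lemma bounded_lipschitz_field_has_flow:
  fixes f :: "'a::banach \<Rightarrow> 'a"
  assumes lip: "K-lipschitz_on UNIV f" and bnd: "\<And>x. norm (f x) \<le> B"
  shows "\<exists>\<theta>. \<theta> 0 = x0 \<and>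
    (\<forall>t\<ge>0. (\<theta> has_vector_derivative f (\<theta> t)) (at t within {0..}))"
proof -
  \<comment> \<open>The contraction factor will be K / c <= 1/2; the summand 1 keeps c positive when
    K = 0.\<close>
  define c where "c = 2 * K + 1"
  have K: "K \<ge> 0" using lip by (rule lipschitz_on_nonneg)
  then have c: "c \<ge> 1" "K / c \<le> 1 / 2" by (auto simp: c_def field_simps)
  have B: "B \<ge> 0" using bnd[of 0] norm_ge_zero order_trans by blast
  have contf: "continuous_on UNIV f" using lip by (rule lipschitz_on_continuous_on)
  define h where "h y s = f (exp (c * s) *\<^sub>R apply_bcontfun y s)" for y :: "real \<Rightarrow>\<^sub>C 'a" and s
  have conth: "continuous_on A (h y)" for y A
    unfolding h_def
    by (rule continuous_on_compose2[OF contf]) (auto intro!: continuous_intros)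
  have inth: "h y integrable_on {0..u}" for y u
    by (intro integrable_continuous_real conth)
  define I where "I y u = integral {0..u} (h y)" for y and u :: real
  have derI: "(I y has_vector_derivative h y t) (at t within {0..})" if "t \<ge> 0" for y t
    unfolding I_def using integral_has_vector_derivative_atLeast[OF conth that] .
  have contI: "continuous_on {0..} (I y)" for y
    unfolding continuous_on_eq_continuous_within
    using derI by (blast intro: has_vector_derivative_continuous atLeast_iff[THEN iffD1])
  \<comment> \<open>Bounded continuous functions live on all of the real line;
    \<open>max 0 t\<close> extends the iterate as a constant to negative times.\<close>
  define T where "T y t = exp (- c * max 0 t) *\<^sub>R (x0 + I y (max 0 t))" for y t
  have expbnd: "exp (- c * u) * u \<le> 1" if "u \<ge> 0" for u :: real
  proof -
    have "u \<le> c * u" using c that by (simp add: mult_le_cancel_right1)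
    also have "\<dots> \<le> exp (c * u)" using exp_ge_add_one_self[of "c * u"] by linarith
    finally show ?thesis by (simp add: exp_minus field_simps)
  qed
  have T_bcont: "T y \<in> bcontfun" for y
  proof (rule bcontfun_normI)
    show "continuous_on UNIV (T y)"
      unfolding T_def
      by (intro continuous_intros continuous_on_compose2[OF contI]) auto
    fix t :: real
    define u where "u = max 0 t"
    have u: "u \<ge> 0" unfolding u_def by (rule max.cobounded1)
    have "norm (I y u) \<le> integral {0..u} (\<lambda>_. B)"
      unfolding I_def
      by (rule integral_norm_bound_integral) (use inth in \<open>auto simp: h_def bnd\<close>)
    also have "\<dots> = B * u" using u by simp
    finally have "norm (x0 + I y u) \<le> norm x0 + B * u"
      using norm_triangle_ineq[of x0 "I y u"] by linarith
    then have "norm (T y t) \<le> exp (- c * u) * (norm x0 + B * u)"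
      by (simp add: T_def u_def[symmetric])
    also have "\<dots> = exp (- c * u) * norm x0 + B * (exp (- c * u) * u)"
      by (simp add: algebra_simps)
    also have "\<dots> \<le> 1 * norm x0 + B * 1"
      using u c B expbnd[OF u] by (intro add_mono mult_mono mult_left_mono) auto
    finally show "norm (T y t) \<le> norm x0 + B" by simp
  qed
  define P where "P y = Bcontfun (T y)" for y
  have P: "apply_bcontfun (P y) = T y" for y
    unfolding P_def using T_bcont by (rule Bcontfun_inverse)
  have contr: "dist (P y) (P z) \<le> 1 / 2 * dist y z" for y z
  proof (rule dist_bound)
    fix t :: real
    define u where "u = max 0 t"
    have u: "u \<ge> 0" unfolding u_def by (rule max.cobounded1)
    \<comment> \<open>Integrating the factor exp (c s), which undoes the weight, supplies the 1 / c
      of the contraction factor.\<close>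
    have hi: "((\<lambda>s. K * dist y z * exp (c * s)) has_integral
        K * dist y z * exp (c * u) / c - K * dist y z * exp (c * 0) / c) {0..u}"
      using u c
      by (intro fundamental_theorem_of_calculus)
        (auto intro!: derivative_eq_intros simp: has_real_derivative_iff_has_vector_derivative[symmetric])
    have hd: "norm (h y s - h z s) \<le> K * dist y z * exp (c * s)" for s
    proof -
      have "norm (h y s - h z s) \<le> K * norm (exp (c * s) *\<^sub>R apply_bcontfun y s - exp (c * s) *\<^sub>R apply_bcontfun z s)"
        using lipschitz_onD[OF lip, of "exp (c * s) *\<^sub>R apply_bcontfun y s" "exp (c * s) *\<^sub>R apply_bcontfun z s"]
        by (simp add: h_def dist_norm)
      also have "\<dots> = K * (exp (c * s) * dist (apply_bcontfun y s) (apply_bcontfun z s))"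
        by (simp add: dist_norm flip: scaleR_diff_right)
      also have "\<dots> \<le> K * (exp (c * s) * dist y z)"
        using K by (intro mult_left_mono dist_bounded) auto
      finally show ?thesis by (simp add: algebra_simps)
    qed
    have "norm (I y u - I z u) = norm (integral {0..u} (\<lambda>s. h y s - h z s))"
      by (simp add: I_def integral_diff inth)
    also have "\<dots> \<le> integral {0..u} (\<lambda>s. K * dist y z * exp (c * s))"
      using hi hd by (intro integral_norm_bound_integral integrable_diff inth) auto
    also have "\<dots> = K * dist y z * exp (c * u) / c - K * dist y z * exp (c * 0) / c"
      using hi by (rule integral_unique)
    also have "\<dots> \<le> K / c * dist y z * exp (c * u)"
      using K c by (simp add: field_simps)
    also have "\<dots> \<le> 1 / 2 * dist y z * exp (c * u)"
      using c by (intro mult_right_mono) auto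
    finally have I: "norm (I y u - I z u) \<le> 1 / 2 * dist y z * exp (c * u)" .
    have "dist (T y t) (T z t) = exp (- c * u) * norm (I y u - I z u)"
      by (simp add: T_def u_def[symmetric] dist_norm flip: scaleR_diff_right)
    also have "\<dots> \<le> exp (- c * u) * (1 / 2 * dist y z * exp (c * u))"
      using I by (rule mult_left_mono) simp
    also have "\<dots> = 1 / 2 * dist y z" by (simp add: exp_minus)
    finally show "dist (apply_bcontfun (P y) t) (apply_bcontfun (P z) t) \<le> 1 / 2 * dist y z"
      by (simp add: P)
  qed
  obtain y where y: "P y = y"
    using banach_fix_type[of "1 / 2" P] contr by auto
  define \<theta> where "\<theta> t = x0 + I y t" for t
  have h\<theta>: "h y t = f (\<theta> t)" if "t \<ge> 0" for t
  proof -
    have "apply_bcontfun y t = T y t" using P[of y] y by simp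
    then show ?thesis using that by (simp add: h_def T_def \<theta>_def exp_minus)
  qed
  have "(\<theta> has_vector_derivative f (\<theta> t)) (at t within {0..})" if "t \<ge> 0" for t
    using derI[OF that, of y] h\<theta>[OF that]
    unfolding \<theta>_def by (auto intro!: derivative_eq_intros)
  moreover have "\<theta> 0 = x0" by (simp add: \<theta>_def I_def)
  ultimately show ?thesis by blast
qed

text \<open>Lipschitz functions are not closed under products, bounded Lipschitz functions are. This
  class allows the truncated field to be checked factor by factor.\<close>

definition bounded_lipschitz :: "('a::metric_space \<Rightarrow> real) \<Rightarrow> bool" where
  "bounded_lipschitz f \<longleftrightarrow> (\<exists>K. K-lipschitz_on UNIV f) \<and> (\<exists>B. \<forall>x. \<bar>f x\<bar> \<le> B)"

lemma bounded_lipschitz_const: "bounded_lipschitz (\<lambda>x. c)"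
  unfolding bounded_lipschitz_def using lipschitz_on_constant by blast

lemma bounded_lipschitz_add:
  assumes "bounded_lipschitz f" "bounded_lipschitz h"
  shows "bounded_lipschitz (\<lambda>x. f x + h x)"
proof -
  obtain K L B C where "K-lipschitz_on UNIV f" "L-lipschitz_on UNIV h"
    and bnd: "\<And>x. \<bar>f x\<bar> \<le> B" "\<And>x. \<bar>h x\<bar> \<le> C"
    using assms unfolding bounded_lipschitz_def by blast
  moreover have "\<bar>f x + h x\<bar> \<le> B + C" for x using bnd[of x] by linarith
  ultimately show ?thesis unfolding bounded_lipschitz_def by (blast intro: lipschitz_on_add)
qed

lemma bounded_lipschitz_mult:
  assumes "bounded_lipschitz f" "bounded_lipschitz h"
  shows "bounded_lipschitz (\<lambda>x. f x * h x)"
proof -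
  obtain K L B C where lip: "K-lipschitz_on UNIV f" "L-lipschitz_on UNIV h"
    and bnd: "\<And>x. \<bar>f x\<bar> \<le> B" "\<And>x. \<bar>h x\<bar> \<le> C"
    using assms unfolding bounded_lipschitz_def by blast
  have nn: "0 \<le> K" "0 \<le> L" using lip by (auto intro: lipschitz_on_nonneg)
  have B: "0 \<le> B" "0 \<le> C"
    using bnd[of undefined] abs_ge_zero order_trans by blast+
  have "(B * L + K * C)-lipschitz_on UNIV (\<lambda>x. f x * h x)"
  proof (rule lipschitz_onI)
    fix x y
    have "f x * h x - f y * h y = f x * (h x - h y) + (f x - f y) * h y"
      by (simp add: algebra_simps)
    then have "\<bar>f x * h x - f y * h y\<bar> \<le> \<bar>f x\<bar> * \<bar>h x - h y\<bar> + \<bar>f x - f y\<bar> * \<bar>h y\<bar>"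
      by (metis abs_mult abs_triangle_ineq)
    also have "\<dots> \<le> B * (L * dist x y) + (K * dist x y) * C"
      using lipschitz_onD[OF lip(1), of x y] lipschitz_onD[OF lip(2), of x y] bnd nn B
      by (intro add_mono mult_mono) (auto simp: dist_real_def)
    finally show "dist (f x * h x) (f y * h y) \<le> (B * L + K * C) * dist x y"
      by (simp add: dist_real_def algebra_simps)
  qed (use nn B in auto)
  moreover have "\<bar>f x * h x\<bar> \<le> B * C" for x
    unfolding abs_mult using bnd B by (intro mult_mono) auto
  ultimately show ?thesis unfolding bounded_lipschitz_def by blast
qed

lemma bounded_lipschitz_compose:
  assumes "L-lipschitz_on UNIV h" "bounded_lipschitz f"
  shows "bounded_lipschitz (\<lambda>x. h (f x))"
proof -
  obtain K B where lip: "K-lipschitz_on UNIV f" and bnd: "\<And>x. \<bar>f x\<bar> \<le> B"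
    using assms unfolding bounded_lipschitz_def by blast
  have "(L * K)-lipschitz_on UNIV (\<lambda>x. h (f x))"
    using lip lipschitz_on_subset[OF assms(1)] by (intro lipschitz_on_compose2) auto
  moreover have "\<bar>h (f x)\<bar> \<le> \<bar>h 0\<bar> + L * B" for x
  proof -
    have "\<bar>h (f x) - h 0\<bar> \<le> L * \<bar>f x\<bar>"
      using lipschitz_onD[OF assms(1), of "f x" 0] by (simp add: dist_real_def)
    also have "\<dots> \<le> L * B"
      using bnd lipschitz_on_nonneg[OF assms(1)] by (intro mult_left_mono) auto
    finally show ?thesis by linarith
  qed
  ultimately show ?thesis unfolding bounded_lipschitz_def by blast
qed

lemma bounded_lipschitz_truncate:
  assumes "K-lipschitz_on UNIV f"
  shows "bounded_lipschitz (\<lambda>x. max a (min b (f x)))"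
proof -
  have "K-lipschitz_on UNIV (\<lambda>x. max a (min b (f x)))"
  proof (rule lipschitz_onI)
    fix x y
    have "dist (max a (min b (f x))) (max a (min b (f y))) \<le> dist (f x) (f y)"
      by (auto simp: dist_real_def max_def min_def)
    then show "dist (max a (min b (f x))) (max a (min b (f y))) \<le> K * dist x y"
      using lipschitz_onD[OF assms, of x y] by simp
  qed (use lipschitz_on_nonneg[OF assms] in auto)
  moreover have "\<bar>max a (min b (f x))\<bar> \<le> \<bar>a\<bar> + \<bar>b\<bar>" for x by linarith
  ultimately show ?thesis unfolding bounded_lipschitz_def by blast
qed

lemma lipschitz_on_fst: "1-lipschitz_on UNIV fst" and lipschitz_on_snd: "1-lipschitz_on UNIV snd"
  by (rule lipschitz_onI; simp add: dist_fst_le dist_snd_le)+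

lemma lipschitz_on_abs: "1-lipschitz_on UNIV (abs :: real \<Rightarrow> real)"
  by (rule lipschitz_onI) (auto simp: dist_real_def)

section \<open>Real functions on a half-line\<close>

lemma DERIV_mult_abs_self: "((\<lambda>x::real. x * \<bar>x\<bar>) has_real_derivative 2 * \<bar>x\<bar>) (at x)"
proof (cases "x = 0")
  case True
  have "(\<lambda>h::real. \<bar>h\<bar>) \<midarrow>0\<rightarrow> 0"
    by (rule tendsto_rabs_zero) (rule tendsto_ident_at)
  then have "(\<lambda>h::real. h * \<bar>h\<bar> / h) \<midarrow>0\<rightarrow> 0"
    by (rule Lim_transform_eventually) (auto simp: eventually_at intro!: exI[of _ 1])
  then show ?thesis using True by (simp add: DERIV_def)
next
  case False
  then consider "x > 0" | "x < 0" by linarith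
  then show ?thesis
  proof cases
    case 1
    have "((\<lambda>x::real. x * x) has_real_derivative 2 * \<bar>x\<bar>) (at x)"
      using 1 by (auto intro!: derivative_eq_intros)
    then show ?thesis
      by (rule has_field_derivative_transform_within_open[where S = "{0<..}"]) (use 1 in auto)
  next
    case 2
    have "((\<lambda>x::real. - (x * x)) has_real_derivative 2 * \<bar>x\<bar>) (at x)"
      using 2 by (auto intro!: derivative_eq_intros)
    then show ?thesis
      by (rule has_field_derivative_transform_within_open[where S = "{..<0}"]) (use 2 in auto)
  qed
qed

lemma mult_abs_self_strict_mono:
  fixes x y :: real
  assumes "x < y" shows "x * \<bar>x\<bar> < y * \<bar>y\<bar>"
proof -
  consider "0 \<le> x" | "x < 0" "0 \<le> y" | "y < 0" by linarith
  then show ?thesis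
  proof cases
    case 1
    then show ?thesis using assms by (simp add: mult_strict_mono')
  next
    case 2
    then have "x * \<bar>x\<bar> < 0" "0 \<le> y * \<bar>y\<bar>" by (auto simp: mult_neg_neg)
    then show ?thesis by linarith
  next
    case 3
    then show ?thesis using assms mult_strict_mono'[of "- y" "- x" "- y" "- x"] by simp
  qed
qed

lemma mult_abs_self_le_iff: "x * \<bar>x\<bar> \<le> y * \<bar>y\<bar> \<longleftrightarrow> x \<le> (y::real)"
  using mult_abs_self_strict_mono[of x y] mult_abs_self_strict_mono[of y x] by (cases x y rule: linorder_cases) auto

lemma nondecreasing_on_segment:
  fixes f :: "real \<Rightarrow> real"
  assumes "0 \<le> s" "s \<le> T"
    and "\<And>t. s \<le> t \<Longrightarrow> t \<le> T \<Longrightarrow> (f has_real_derivative f' t) (at t within {0..})"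
    and "\<And>t. s < t \<Longrightarrow> t < T \<Longrightarrow> 0 \<le> f' t"
  shows "f s \<le> f T"
proof (cases "s = T")
  case False
  then have "s < T" using assms by simp
  moreover have "(f has_derivative (*) (f' t)) (at t within {s..T})" if "s \<le> t" "t \<le> T" for t
    using has_field_derivative_subset[OF assms(3)[OF that], of "{s..T}"] assms(1)
    by (auto simp: has_field_derivative_def)
  ultimately obtain t where "t \<in> {s<..<T}" "f T - f s = f' t * (T - s)"
    using mvt_simple[of s T f "\<lambda>t. (*) (f' t)"] by blast
  moreover have "0 \<le> f' t * (T - s)"
    using assms(4)[of t] calculation \<open>s < T\<close> by (intro mult_nonneg_nonneg) auto
  ultimately show ?thesis by linarith
qed simp

lemma nonincreasing_on_segment:
  fixes f :: "real \<Rightarrow> real"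
  assumes "0 \<le> s" "s \<le> T"
    and "\<And>t. s \<le> t \<Longrightarrow> t \<le> T \<Longrightarrow> (f has_real_derivative f' t) (at t within {0..})"
    and "\<And>t. s < t \<Longrightarrow> t < T \<Longrightarrow> f' t \<le> 0"
  shows "f T \<le> f s"
  using nondecreasing_on_segment[of s T "\<lambda>t. - f t" "\<lambda>t. - f' t"] assms
  by (auto intro!: derivative_eq_intros)

text \<open>The last visit is the supremum of the sublevel set. It reduces barrier arguments to a
  time interval on which f stays strictly on one side of c, where the sign of a derivative is
  known.\<close>

lemma last_visit:
  fixes f :: "real \<Rightarrow> real"
  assumes cont: "continuous_on {r..T} f" and "r \<le> T" "f r \<le> c" "c < f T"
  shows "\<exists>s. r \<le> s \<and> s < T \<and> f s = c \<and> (\<forall>u. s < u \<and> u \<le> T \<longrightarrow> c < f u)"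
proof -
  define S where "S = {s \<in> {r..T}. f s \<le> c}"
  have "S = {r..T} \<inter> f -` {..c}" by (auto simp: S_def)
  then have "closed S" using continuous_closed_preimage[OF cont] by simp
  moreover have ne: "r \<in> S" and bdd: "bdd_above S" using assms by (auto simp: S_def)
  ultimately have "Sup S \<in> S" using closed_contains_Sup by blast
  define s where "s = Sup S"
  have s: "r \<le> s" "s \<le> T" "f s \<le> c"
    using \<open>Sup S \<in> S\<close> by (auto simp: S_def s_def)
  have above: "c < f u" if "s < u" "u \<le> T" for u
    using that cSup_upper[OF _ bdd, of u] s by (force simp: S_def s_def)
  have "s < T" using s assms by (cases "s = T") auto
  moreover have "f s = c"
  proof (rule ccontr)
    assume "f s \<noteq> c"
    moreover obtain u where "s \<le> u" "u \<le> T" "f u = c"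
      using IVT'[of f s c T] s assms continuous_on_subset[OF cont, of "{s..T}"] by auto
    ultimately show False using above[of u] by (cases "u = s") auto
  qed
  ultimately show ?thesis using s above by blast
qed

lemma last_visit_from_above:
  fixes f :: "real \<Rightarrow> real"
  assumes "continuous_on {r..T} f" and "r \<le> T" "c \<le> f r" "f T < c"
  shows "\<exists>s. r \<le> s \<and> s < T \<and> f s = c \<and> (\<forall>u. s < u \<and> u \<le> T \<longrightarrow> f u < c)"
  using last_visit[OF continuous_on_minus[OF assms(1)] assms(2), of "- c"] assms(3,4) by simp

lemma nondecreasing_bounded_tendsto:
  fixes f :: "real \<Rightarrow> real"
  assumes mono: "\<And>s t. T \<le> s \<Longrightarrow> s \<le> t \<Longrightarrow> f s \<le> f t" and bound: "\<And>t. T \<le> t \<Longrightarrow> f t \<le> C"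
  shows "\<exists>l. (f \<longlongrightarrow> l) at_top"
proof -
  have bdd: "bdd_above (f ` {T..})" using bound by (intro bdd_aboveI[of _ C]) auto
  have "(f \<longlongrightarrow> Sup (f ` {T..})) at_top"
  proof (rule increasing_tendsto)
    show "\<forall>\<^sub>F t in at_top. f t \<le> Sup (f ` {T..})"
      using eventually_ge_at_top[of T] by eventually_elim (auto intro: cSup_upper bdd)
    fix y assume "y < Sup (f ` {T..})"
    then obtain s where s: "T \<le> s" "y < f s"
      using less_cSup_iff[OF _ bdd] by auto
    show "\<forall>\<^sub>F t in at_top. y < f t"
      using eventually_ge_at_top[of s] by eventually_elim (use s mono in \<open>auto intro: less_le_trans\<close>)
  qed
  then show ?thesis by blast
qed

lemma nonincreasing_bounded_tendsto:
  fixes f :: "real \<Rightarrow> real"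
  assumes "\<And>s t. T \<le> s \<Longrightarrow> s \<le> t \<Longrightarrow> f t \<le> f s" and "\<And>t. T \<le> t \<Longrightarrow> C \<le> f t"
  shows "\<exists>l. (f \<longlongrightarrow> l) at_top"
proof -
  obtain l where "((\<lambda>t. - f t) \<longlongrightarrow> l) at_top"
    using nondecreasing_bounded_tendsto[of T "\<lambda>t. - f t" "- C"] assms by auto
  then have "(f \<longlongrightarrow> - l) at_top" using tendsto_minus by fastforce
  then show ?thesis by blast
qed

text \<open>A nonzero limit of the square forbids late zeros, so connectedness of the image fixes
  the sign.\<close>

lemma tendsto_if_square_tendsto:
  fixes f :: "real \<Rightarrow> real"
  assumes cont: "continuous_on {0..} f" and lim: "((\<lambda>t. (f t)\<^sup>2) \<longlongrightarrow> l) at_top"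
  shows "\<exists>l'. (f \<longlongrightarrow> l') at_top"
proof (cases "l = 0")
  case True
  then have "((\<lambda>t. \<bar>f t\<bar>) \<longlongrightarrow> 0) at_top"
    using tendsto_real_sqrt[OF lim] by simp
  then show ?thesis using tendsto_rabs_zero_iff by blast
next
  case False
  have abs: "((\<lambda>t. \<bar>f t\<bar>) \<longlongrightarrow> sqrt l) at_top"
    using tendsto_real_sqrt[OF lim] by simp
  have "l \<ge> 0" using tendsto_lowerbound[OF lim, of 0] by simp
  with False have "\<forall>\<^sub>F t in at_top. (f t)\<^sup>2 > 0" by (intro order_tendstoD(1)[OF lim]) auto
  then obtain T0 where T0: "\<And>t. t \<ge> T0 \<Longrightarrow> f t \<noteq> 0"
    by (auto simp: eventually_at_top_linorder)
  define T where "T = max T0 0"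
  have nz: "f t \<noteq> 0" if "t \<ge> T" for t using T0 that by (auto simp: T_def)
  have conn: "connected (f ` {T..})"
    using cont by (intro connected_continuous_image) (auto simp: T_def intro: continuous_on_subset)
  have "(\<forall>t\<ge>T. f t > 0) \<or> (\<forall>t\<ge>T. f t < 0)"
  proof (rule ccontr)
    assume "\<not> ?thesis"
    then obtain s t where "s \<ge> T" "f s < 0" "t \<ge> T" "f t > 0"
      by (metis nz linorder_neqE_linordered_idom)
    then have "0 \<in> f ` {T..}"
      using connectedD_interval[OF conn, of "f s" "f t" 0] by auto
    then show False using nz by auto
  qed
  then show ?thesis
  proof
    assume "\<forall>t\<ge>T. f t > 0"
    then have "(f \<longlongrightarrow> sqrt l) at_top"
      by (intro Lim_transform_eventually[OF abs])
        (auto simp: eventually_at_top_linorder intro!: exI[of _ T])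
    then show ?thesis by blast
  next
    assume neg: "\<forall>t\<ge>T. f t < 0"
    have "(f \<longlongrightarrow> - sqrt l) at_top"
      by (intro Lim_transform_eventually[OF tendsto_minus[OF abs]])
        (use neg in \<open>auto simp: eventually_at_top_linorder intro!: exI[of _ T]\<close>)
    then show ?thesis by blast
  qed
qed

text \<open>Increments over unit intervals tend to 0 and, by the mean value theorem, are values of
  the derivative. Applied to both coordinates of a flow, this makes its limit an
  equilibrium.\<close>

lemma derivative_limit_zero:
  fixes f :: "real \<Rightarrow> real"
  assumes der: "\<And>t. t \<ge> 0 \<Longrightarrow> (f has_real_derivative f' t) (at t within {0..})"
    and f: "(f \<longlongrightarrow> l) at_top" and f': "(f' \<longlongrightarrow> c) at_top"
  shows "c = 0"
proof (rule ccontr)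
  assume "c \<noteq> 0"
  have "((\<lambda>t. f (t + 1) - f t) \<longlongrightarrow> l - l) at_top"
    by (intro tendsto_diff f filterlim_compose[OF f] filterlim_tendsto_add_at_top[OF tendsto_const])
      (auto simp: add.commute[of _ 1] intro!: filterlim_tendsto_add_at_top[OF tendsto_const] filterlim_ident)
  then have "\<forall>\<^sub>F t in at_top. dist (f (t + 1) - f t) 0 < \<bar>c\<bar> / 2"
    using \<open>c \<noteq> 0\<close> by (intro tendstoD) auto
  moreover have "\<forall>\<^sub>F t in at_top. dist (f' t) c < \<bar>c\<bar> / 2"
    using \<open>c \<noteq> 0\<close> by (intro tendstoD[OF f']) auto
  ultimately obtain T where T: "\<And>t. t \<ge> T \<Longrightarrow> \<bar>f (t + 1) - f t\<bar> < \<bar>c\<bar> / 2"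
    "\<And>t. t \<ge> T \<Longrightarrow> \<bar>f' t - c\<bar> < \<bar>c\<bar> / 2"
    by (auto simp: eventually_at_top_linorder dist_real_def) (metis linorder_le_cases order_trans)
  define s where "s = max T 0"
  have "(f has_derivative (*) (f' t)) (at t within {s..s + 1})" if "s \<le> t" "t \<le> s + 1" for t
    using has_field_derivative_subset[OF der[of t], of "{s..s + 1}"] that
    by (auto simp: has_field_derivative_def s_def)
  then obtain t where "t \<in> {s<..<s + 1}" "f (s + 1) - f s = f' t"
    using mvt_simple[of s "s + 1" f "\<lambda>t. (*) (f' t)"] by auto
  then have "\<bar>f' t\<bar> < \<bar>c\<bar> / 2" "\<bar>f' t - c\<bar> < \<bar>c\<bar> / 2"
    using T(1)[of s] T(2)[of t] by (auto simp: s_def)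
  then show False by linarith
qed

section \<open>Orbits of the flow\<close>

lemma one_plus_mult_abs_le_0_iff: "1 + 2 * w * \<bar>w\<bar> \<le> 0 \<longleftrightarrow> w \<le> - 1 / sqrt 2"
  using mult_abs_self_le_iff[of w "- 1 / sqrt 2"] by simp linarith

lemma one_plus_mult_abs_ge_0_iff: "0 \<le> 1 + 2 * w * \<bar>w\<bar> \<longleftrightarrow> - 1 / sqrt 2 \<le> w"
  using mult_abs_self_le_iff[of "- 1 / sqrt 2" w] by simp linarith

text \<open>The square of \<open>g\<close>, kept free of the root; e^2 = \<open>barrier w\<close> is
  the energy level of the point (0, -1/sqrt 2).\<close>

definition barrier :: "real \<Rightarrow> real" where
  "barrier w = w\<^sup>2 - ln (- w) + E_sad"

text \<open>Twice \<open>barrier w\<close> is x - 1 - ln x at x = 2 w^2.\<close>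

lemma barrier_nonneg:
  assumes "w < 0" shows "0 \<le> barrier w"
proof -
  have "ln (2 * w\<^sup>2) \<le> 2 * w\<^sup>2 - 1" using assms by (intro ln_le_minus_one) simp
  moreover have "ln (2 * w\<^sup>2) = ln 2 + 2 * ln (- w)"
    using assms ln_realpow[of "- w" 2] by (simp add: ln_mult)
  ultimately show ?thesis by (simp add: barrier_def E_sad_def field_simps)
qed

text \<open>Equality in ln x <= x - 1 holds only at x = 1.\<close>

lemma barrier_eq_0_iff:
  assumes "w < 0" shows "barrier w = 0 \<longleftrightarrow> w = - 1 / sqrt 2"
proof
  have ln: "ln (2 * w\<^sup>2) = ln 2 + 2 * ln (- w)"
    using assms ln_realpow[of "- w" 2] by (simp add: ln_mult)
  {
    assume "barrier w = 0"
    then have "ln (2 * w\<^sup>2) = 2 * w\<^sup>2 - 1" unfolding ln by (simp add: barrier_def E_sad_def field_simps)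
    then have "2 * w\<^sup>2 = 1" using assms by (intro ln_eq_minus_one) auto
    then have "(- w)\<^sup>2 = (1 / sqrt 2)\<^sup>2" by (simp add: power_divide)
    then show "w = - 1 / sqrt 2" using assms by (subst (asm) power2_eq_iff_nonneg) auto
  next
    assume "w = - 1 / sqrt 2"
    then have "2 * w\<^sup>2 = 1" by (simp add: power_divide)
    then have "ln 2 + 2 * ln (- w) = 0" using ln by simp
    then show "barrier w = 0" using \<open>2 * w\<^sup>2 = 1\<close> by (simp add: barrier_def E_sad_def field_simps)
  }
qed

lemma g_power2: "w < 0 \<Longrightarrow> (g w)\<^sup>2 = barrier w"
  using barrier_nonneg by (simp add: g_def barrier_def)

lemma g_nonneg: "w < 0 \<Longrightarrow> 0 \<le> g w"
  using barrier_nonneg by (simp add: g_def barrier_def)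

lemma neg_inv_sqrt2_less: "- 1 / sqrt 2 < (0::real)" "- 1 / sqrt 2 < (- 1 / 2 :: real)"
proof -
  show "- 1 / sqrt 2 < (0::real)" by simp
  have "sqrt 2 < sqrt 4" by (simp only: real_sqrt_less_iff)
  then have "sqrt 2 < 2" by simp
  then show "- 1 / sqrt 2 < (- 1 / 2 :: real)" by (simp add: field_simps)
qed

lemma mem_I_min_iff: "(e, w) \<in> I_min \<longleftrightarrow> w < - 1 / sqrt 2 \<and> e\<^sup>2 < barrier w"
proof (cases "w < - 1 / sqrt 2")
  case True
  then have "w < 0" using neg_inv_sqrt2_less(1) by linarith
  then have "e\<^sup>2 < barrier w \<longleftrightarrow> \<bar>e\<bar> < g w"
    using abs_le_square_iff[of "g w" e] g_nonneg[of w] by (auto simp flip: g_power2)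
  then show ?thesis using True by (auto simp: I_min_def)
qed (auto simp: I_min_def)

lemma mem_I_sad_iff: "(e, w) \<in> I_sad \<longleftrightarrow> w \<le> - 1 / sqrt 2 \<and> e\<^sup>2 = barrier w"
proof (cases "w \<le> - 1 / sqrt 2")
  case True
  then have "w < 0" using neg_inv_sqrt2_less(1) by linarith
  then have "e\<^sup>2 = barrier w \<longleftrightarrow> e = g w \<or> e = - g w"
    by (simp flip: g_power2 add: power2_eq_iff)
  then show ?thesis using True by (auto simp: I_sad_def)
qed (auto simp: I_sad_def)

definition signal :: "real \<Rightarrow> real \<Rightarrow> real" where
  "signal e w = e\<^sup>2 * (1 + 2 * w * \<bar>w\<bar>)"

text \<open>
  The gradient flow up to a change of time: the speed \<open>\<rho>\<close> is only constrained in sign, so that the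
  orbit bounds below also apply to the flow of the truncated field that is used for existence.
\<close>

locale rescaled_flow =
  fixes e w \<rho> :: "real \<Rightarrow> real" and a :: real
  assumes e_deriv: "t \<ge> 0 \<Longrightarrow>
      (e has_real_derivative 2 * \<rho> t * e t * (1 + 2 * w t * \<bar>w t\<bar>)) (at t within {0..})"
    and w_deriv: "t \<ge> 0 \<Longrightarrow> (w has_real_derivative 4 * \<rho> t * (e t)\<^sup>2 * \<bar>w t\<bar>) (at t within {0..})"
    and speed_nonneg: "t \<ge> 0 \<Longrightarrow> signal (e t) (w t) \<le> a \<Longrightarrow> 0 \<le> \<rho> t"
    and speed_nonpos: "t \<ge> 0 \<Longrightarrow> a \<le> signal (e t) (w t) \<Longrightarrow> \<rho> t \<le> 0"
    and speed_cont: "continuous_on {0..} \<rho>"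
    and a_pos: "a > 0"
begin

lemma cont_e: "continuous_on {0..} e" and cont_w: "continuous_on {0..} w"
  unfolding continuous_on_eq_continuous_within
  using e_deriv w_deriv by (blast intro: DERIV_continuous atLeast_iff[THEN iffD1])+

lemma slope_deriv: "t \<ge> 0 \<Longrightarrow> ((\<lambda>t. 1 + 2 * w t * \<bar>w t\<bar>) has_real_derivative
    16 * \<rho> t * (e t)\<^sup>2 * (w t)\<^sup>2) (at t within {0..})"
proof -
  assume t: "t \<ge> 0"
  have "((\<lambda>t. 1 + 2 * (w t * \<bar>w t\<bar>)) has_real_derivative
      0 + 2 * (2 * \<bar>w t\<bar> * (4 * \<rho> t * (e t)\<^sup>2 * \<bar>w t\<bar>))) (at t within {0..})"
    by (intro DERIV_add DERIV_const DERIV_cmult DERIV_chain2[OF DERIV_mult_abs_self] w_deriv t)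
  moreover have "0 + 2 * (2 * \<bar>w t\<bar> * (4 * \<rho> t * (e t)\<^sup>2 * \<bar>w t\<bar>))
      = 16 * \<rho> t * (e t)\<^sup>2 * (\<bar>w t\<bar> * \<bar>w t\<bar>)"
    by (simp only: mult_ac add_0)
  ultimately show ?thesis by (simp only: mult.assoc power2_eq_square abs_mult_self_eq)
qed

lemma e_square_deriv: "t \<ge> 0 \<Longrightarrow> ((\<lambda>t. (e t)\<^sup>2) has_real_derivative
    4 * \<rho> t * (e t)\<^sup>2 * (1 + 2 * w t * \<bar>w t\<bar>)) (at t within {0..})"
  by (auto intro!: derivative_eq_intros e_deriv simp: power2_eq_square)

section \<open>Monotonicity and a priori bounds along an orbit\<close>

definition A :: "real \<Rightarrow> real" where "A t = signal (e t) (w t)"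

text \<open>The squared norm of the gradient of \<open>signal\<close>, hence the rate of change of
  \<open>A\<close> per unit of speed.\<close>

definition m :: "real \<Rightarrow> real" where
  "m t = 4 * (e t)\<^sup>2 * (1 + 2 * w t * \<bar>w t\<bar>)\<^sup>2 + 16 * ((e t)\<^sup>2)\<^sup>2 * (w t)\<^sup>2"

lemma m_nonneg: "0 \<le> m t"
  by (simp add: m_def)

lemma A_deriv: "t \<ge> 0 \<Longrightarrow> (A has_real_derivative \<rho> t * m t) (at t within {0..})"
  unfolding A_def signal_def m_def
  by (rule derivative_eq_intros e_square_deriv slope_deriv | assumption)+
    (simp add: algebra_simps power2_eq_square)

lemma cont_A: "continuous_on {0..} A"
  unfolding continuous_on_eq_continuous_within
  using A_deriv by (blast intro: DERIV_continuous atLeast_iff[THEN iffD1])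

text \<open>After its last visit to the level a the orbit would lie above it, where the speed is
  nonpositive, so \<open>A\<close> cannot have risen.\<close>

lemma A_le:
  assumes "A 0 \<le> a" "0 \<le> t" shows "A t \<le> a"
proof (rule ccontr)
  assume "\<not> ?thesis"
  then have "a < A t" by simp
  then obtain s where s: "0 \<le> s" "s < t" "A s = a" "\<And>u. s < u \<Longrightarrow> u \<le> t \<Longrightarrow> a < A u"
    using last_visit[OF continuous_on_subset[OF cont_A, of "{0..t}"] assms(2,1)] by auto
  have "A t \<le> A s"
  proof (rule nonincreasing_on_segment[where f = A and f' = "\<lambda>t. \<rho> t * m t"])
    show "\<rho> u * m u \<le> 0" if "s < u" "u < t" for u
      using speed_nonpos[of u] s(1) s(4)[of u] that m_nonneg[of u]
      by (simp add: A_def mult_nonpos_nonneg)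
  qed (use s A_deriv in auto)
  then show False using s(2,3) s(4)[of t] by simp
qed

lemma A_ge:
  assumes "a \<le> A 0" "0 \<le> t" shows "a \<le> A t"
proof (rule ccontr)
  assume "\<not> ?thesis"
  then have "A t < a" by simp
  then obtain s where s: "0 \<le> s" "s < t" "A s = a" "\<And>u. s < u \<Longrightarrow> u \<le> t \<Longrightarrow> A u < a"
    using last_visit_from_above[OF continuous_on_subset[OF cont_A, of "{0..t}"] assms(2,1)] by auto
  have "A s \<le> A t"
  proof (rule nondecreasing_on_segment[where f = A and f' = "\<lambda>t. \<rho> t * m t"])
    show "0 \<le> \<rho> u * m u" if "s < u" "u < t" for u
      using speed_nonneg[of u] s(1) s(4)[of u] that m_nonneg[of u]
      by (simp add: A_def)
  qed (use s A_deriv in auto)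
  then show False using s(2,3) s(4)[of t] by simp
qed

lemma speed_nonneg': "A 0 \<le> a \<Longrightarrow> 0 \<le> t \<Longrightarrow> 0 \<le> \<rho> t"
  using A_le[of t] speed_nonneg[of t] by (simp add: A_def)

lemma speed_nonpos': "a \<le> A 0 \<Longrightarrow> 0 \<le> t \<Longrightarrow> \<rho> t \<le> 0"
  using A_ge[of t] speed_nonpos[of t] by (simp add: A_def)

lemma w_mono: "A 0 \<le> a \<Longrightarrow> 0 \<le> s \<Longrightarrow> s \<le> t \<Longrightarrow> w s \<le> w t"
  by (rule nondecreasing_on_segment[where f = w and f' = "\<lambda>t. 4 * \<rho> t * (e t)\<^sup>2 * \<bar>w t\<bar>"])
    (auto intro!: w_deriv mult_nonneg_nonneg speed_nonneg')

lemma w_antimono: "a \<le> A 0 \<Longrightarrow> 0 \<le> s \<Longrightarrow> s \<le> t \<Longrightarrow> w t \<le> w s"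
  by (rule nonincreasing_on_segment[where f = w and f' = "\<lambda>t. 4 * \<rho> t * (e t)\<^sup>2 * \<bar>w t\<bar>"])
    (auto intro!: w_deriv simp: mult_le_0_iff speed_nonpos')

lemma e_square_mono:
  assumes "A 0 \<le> a" "0 \<le> s" "s \<le> t" "- 1 / sqrt 2 \<le> w s"
  shows "(e s)\<^sup>2 \<le> (e t)\<^sup>2"
proof (rule nondecreasing_on_segment[where f = "\<lambda>t. (e t)\<^sup>2"])
  show "0 \<le> 4 * \<rho> u * (e u)\<^sup>2 * (1 + 2 * w u * \<bar>w u\<bar>)" if "s < u" "u < t" for u
    using w_mono[of s u] assms that one_plus_mult_abs_ge_0_iff[of "w u"]
    by (intro mult_nonneg_nonneg speed_nonneg') auto
qed (use assms in \<open>auto intro: e_square_deriv\<close>)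

lemma e_square_antimono:
  assumes "A 0 \<le> a" "0 \<le> s" "s \<le> t" "w t \<le> - 1 / sqrt 2"
  shows "(e t)\<^sup>2 \<le> (e s)\<^sup>2"
proof (rule nonincreasing_on_segment[where f = "\<lambda>t. (e t)\<^sup>2"])
  show "4 * \<rho> u * (e u)\<^sup>2 * (1 + 2 * w u * \<bar>w u\<bar>) \<le> 0" if "s < u" "u < t" for u
    using w_mono[of u t] assms that one_plus_mult_abs_le_0_iff[of "w u"]
    by (intro mult_nonneg_nonpos mult_nonneg_nonneg speed_nonneg') auto
qed (use assms in \<open>auto intro: e_square_deriv\<close>)

lemma slope_pos:
  assumes "a \<le> A 0" "0 \<le> t" shows "0 < 1 + 2 * w t * \<bar>w t\<bar>"
  using A_ge[OF assms] a_pos zero_le_power2[of "e t"]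
  by (auto simp: A_def signal_def zero_less_mult_iff dest: less_le_trans)

lemma e_square_antimono':
  assumes "a \<le> A 0" "0 \<le> s" "s \<le> t"
  shows "(e t)\<^sup>2 \<le> (e s)\<^sup>2"
proof (rule nonincreasing_on_segment[where f = "\<lambda>t. (e t)\<^sup>2"])
  show "4 * \<rho> u * (e u)\<^sup>2 * (1 + 2 * w u * \<bar>w u\<bar>) \<le> 0" if "s < u" "u < t" for u
    using assms that slope_pos[of u] speed_nonpos'[of u]
      by (auto simp: mult_le_0_iff)
qed (use assms in \<open>auto intro: e_square_deriv\<close>)

lemma e_square_minus_w_deriv: "t \<ge> 0 \<Longrightarrow> ((\<lambda>t. (e t)\<^sup>2 - w t) has_real_derivative
    4 * \<rho> t * (e t)\<^sup>2 * (1 + 2 * w t * \<bar>w t\<bar> - \<bar>w t\<bar>)) (at t within {0..})"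
  by (rule derivative_eq_intros e_square_deriv w_deriv | assumption)+
    (simp add: algebra_simps)

text \<open>Below the critical signal two regimes meet at w = -1/2. To the left, 1 + 2 w |w| - |w| =
  (2 w + 1)(1 - w) is nonpositive, so e^2 - w cannot grow; to the right, 1 + 2 w |w| is at least
  1/2, so the cap a on the signal gives e^2 <= 2 a. Above the critical signal e^2 does not increase
  at all.\<close>

lemma e_square_le:
  assumes "0 \<le> t" shows "(e t)\<^sup>2 \<le> (e 0)\<^sup>2 + \<bar>w 0\<bar> + 2 * a"
proof (cases "A 0 \<le> a")
  case True
  show ?thesis
  proof (cases "w t \<le> - 1 / 2")
    case wt: True
    have "(e t)\<^sup>2 - w t \<le> (e 0)\<^sup>2 - w 0"
    proof (rule nonincreasing_on_segment[where f = "\<lambda>t. (e t)\<^sup>2 - w t"])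
      show "4 * \<rho> u * (e u)\<^sup>2 * (1 + 2 * w u * \<bar>w u\<bar> - \<bar>w u\<bar>) \<le> 0" if "0 < u" "u < t" for u
      proof -
        have "w u \<le> - 1 / 2" using w_mono[OF True, of u t] wt that by auto
        then have "(2 * w u + 1) * (w u - 1) \<ge> 0" by (intro mult_nonpos_nonpos) auto
        then have "1 + 2 * w u * \<bar>w u\<bar> - \<bar>w u\<bar> \<le> 0"
          using \<open>w u \<le> - 1 / 2\<close> by (simp add: algebra_simps)
        then show ?thesis
          using that True by (intro mult_nonneg_nonpos mult_nonneg_nonneg speed_nonneg') auto
      qed
    qed (use assms in \<open>auto intro: e_square_minus_w_deriv\<close>)
    then show ?thesis using wt a_pos by linarith
  next
    case False
    have "- 1 / 2 * \<bar>- 1 / 2\<bar> \<le> w t * \<bar>w t\<bar>"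
      using False by (subst mult_abs_self_le_iff) simp
    then have "(e t)\<^sup>2 * (1 / 2) \<le> A t"
      unfolding A_def signal_def by (intro mult_left_mono) auto
    also have "\<dots> \<le> a" using A_le[OF True assms] .
    finally have "(e t)\<^sup>2 \<le> 2 * a" by simp
    then show ?thesis using zero_le_power2[of "e 0"] abs_ge_zero[of "w 0"] by linarith
  qed
next
  case False
  then show ?thesis using e_square_antimono'[of 0 t] assms a_pos by auto
qed

text \<open>Where w >= 0, 2 w^2 - w + 1 > 0 keeps e^2 - w from decreasing. Growth of w by more than
  a in that region would thus force e^2 > a, and the signal, which is at least e^2 there, would
  exceed a. Above the critical signal w does not increase, and positivity of the signal keeps it
  above -1/sqrt 2.\<close>

lemma abs_w_le:
  assumes "0 \<le> t" shows "\<bar>w t\<bar> \<le> \<bar>w 0\<bar> + a + 1"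
proof (cases "A 0 \<le> a")
  case True
  have lower: "w 0 \<le> w t" using w_mono[OF True _ assms] by simp
  have "w t \<le> max (w 0) 0 + a"
  proof (rule ccontr)
    define c where "c = max (w 0) 0"
    assume "\<not> ?thesis"
    then have gt: "c + a < w t" by (simp add: c_def)
    then have "w 0 \<le> c" "c < w t" using a_pos by (auto simp: c_def)
    then obtain s where s: "0 \<le> s" "s < t" "w s = c"
      using last_visit[OF continuous_on_subset[OF cont_w, of "{0..t}"] assms] by auto
    have w_nonneg: "0 \<le> w u" if "s \<le> u" for u
      using w_mono[OF True s(1) that] s(3) by (simp add: c_def)
    have "(e s)\<^sup>2 - w s \<le> (e t)\<^sup>2 - w t"
    proof (rule nondecreasing_on_segment[where f = "\<lambda>t. (e t)\<^sup>2 - w t"])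
      show "0 \<le> 4 * \<rho> u * (e u)\<^sup>2 * (1 + 2 * w u * \<bar>w u\<bar> - \<bar>w u\<bar>)" if "s < u" "u < t" for u
      proof -
        have "0 \<le> (w u - 1)\<^sup>2 + (w u)\<^sup>2 + w u" using w_nonneg[of u] that by simp
        then have "0 \<le> 1 + 2 * w u * \<bar>w u\<bar> - \<bar>w u\<bar>"
          using w_nonneg[of u] that by (simp add: algebra_simps power2_eq_square)
        then show ?thesis
          using that s True by (intro mult_nonneg_nonneg speed_nonneg') auto
      qed
    qed (use s in \<open>auto intro: e_square_minus_w_deriv\<close>)
    then have "a < (e t)\<^sup>2" using gt s(3) zero_le_power2[of "e s"] by linarith
    also have "\<dots> \<le> A t"
      using w_nonneg[of t] s(2) by (simp add: A_def signal_def mult_le_cancel_left1)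
    finally show False using A_le[OF True assms] by simp
  qed
  then show ?thesis using lower a_pos by linarith
next
  case False
  then have le: "a \<le> A 0" by simp
  have "- 1 / sqrt 2 \<le> w t"
    using slope_pos[OF le assms] one_plus_mult_abs_ge_0_iff[of "w t"] by simp
  moreover have "- 1 \<le> - 1 / sqrt (2::real)" by simp
  ultimately have "- 1 \<le> w t" by linarith
  then show ?thesis using w_antimono[OF le _ assms] a_pos by auto
qed

text \<open>One bound for both coordinates in terms of the initial point and a alone; the summand 1
  pays for the passage from e^2 to |e|.\<close>

definition R :: real where "R = (e 0)\<^sup>2 + \<bar>w 0\<bar> + 2 * a + 1"

lemma abs_e_bounded: assumes "0 \<le> t" shows "\<bar>e t\<bar> \<le> R"
proof -
  have "0 \<le> (\<bar>e t\<bar> - 1)\<^sup>2 + \<bar>e t\<bar>" by simp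
  then have "\<bar>e t\<bar> \<le> (e t)\<^sup>2 + 1" by (simp add: power2_eq_square algebra_simps)
  then show ?thesis using e_square_le[OF assms] by (simp add: R_def)
qed

lemma abs_w_bounded: "0 \<le> t \<Longrightarrow> \<bar>w t\<bar> \<le> R"
  using abs_w_le[of t] a_pos zero_le_power2[of "e 0"] unfolding R_def by linarith

text \<open>Below the critical signal w is nondecreasing, so once it has reached -1/sqrt 2 it stays
  to the right and e^2 is nondecreasing from then on; if it never gets there, e^2 is nonincreasing
  throughout.\<close>

lemma converges: "\<exists>el wl. (e \<longlongrightarrow> el) at_top \<and> (w \<longlongrightarrow> wl) at_top"
proof -
  have "(\<exists>l. ((\<lambda>t. (e t)\<^sup>2) \<longlongrightarrow> l) at_top) \<and> (\<exists>l. (w \<longlongrightarrow> l) at_top)"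
  proof (cases "A 0 \<le> a")
    case True
    have "\<exists>l. (w \<longlongrightarrow> l) at_top"
      using w_mono[OF True] abs_w_bounded
      by (intro nondecreasing_bounded_tendsto[of 0 _ R]) (auto simp: abs_le_iff)
    moreover have "\<exists>l. ((\<lambda>t. (e t)\<^sup>2) \<longlongrightarrow> l) at_top"
    proof (cases "\<exists>T\<ge>0. - 1 / sqrt 2 \<le> w T")
      case exT: True
      then obtain T where T: "T \<ge> 0" "- 1 / sqrt 2 \<le> w T" by blast
      have "(e s)\<^sup>2 \<le> (e t)\<^sup>2" if "T \<le> s" "s \<le> t" for s t
        using T that w_mono[OF True T(1) that(1)] by (intro e_square_mono[OF True]) auto
      then show ?thesis
        using T e_square_le
        by (intro nondecreasing_bounded_tendsto[of T _ "(e 0)\<^sup>2 + \<bar>w 0\<bar> + 2 * a"]) auto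
    next
      case False
      then have "w t \<le> - 1 / sqrt 2" if "0 \<le> t" for t using that by (meson le_cases)
      then show ?thesis
        using e_square_antimono[OF True]
        by (intro nonincreasing_bounded_tendsto[of 0 _ 0]) simp_all
    qed
    ultimately show ?thesis by blast
  next
    case False
    then have le: "a \<le> A 0" by simp
    have lower: "- R \<le> w t" if "0 \<le> t" for t using abs_w_bounded[OF that] by linarith
    have "\<exists>l. (w \<longlongrightarrow> l) at_top"
      using w_antimono[OF le] lower by (intro nonincreasing_bounded_tendsto[of 0 _ "- R"]) auto
    moreover have "\<exists>l. ((\<lambda>t. (e t)\<^sup>2) \<longlongrightarrow> l) at_top"
      using e_square_antimono'[OF le] by (intro nonincreasing_bounded_tendsto[of 0 _ 0]) auto
    ultimately show ?thesis by blast
  qed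
  then show ?thesis using tendsto_if_square_tendsto[OF cont_e] by blast
qed

text \<open>A Gronwall estimate: (e^2)' = 2 k e^2 with |k| <= K on the compact interval, so e^2 exp
  (- 2 K t) is nonincreasing.\<close>

lemma e_stays_zero:
  assumes "0 \<le> s" "s \<le> t" "e s = 0" shows "e t = 0"
proof -
  define k where "k u = 2 * \<rho> u * (1 + 2 * w u * \<bar>w u\<bar>)" for u
  have "continuous_on {s..t} k" unfolding k_def
    using assms by (auto intro!: continuous_intros intro: continuous_on_subset[OF cont_w]
        continuous_on_subset[OF speed_cont])
  then have "bounded (k ` {s..t})"
    by (intro compact_imp_bounded compact_continuous_image) auto
  then obtain K where K: "\<forall>u\<in>{s..t}. \<bar>k u\<bar> \<le> K"
    unfolding bounded_iff by auto
  have "(e t)\<^sup>2 * exp (- 2 * K * t) \<le> (e s)\<^sup>2 * exp (- 2 * K * s)"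
  proof (rule nonincreasing_on_segment[where f = "\<lambda>t. (e t)\<^sup>2 * exp (- 2 * K * t)"])
    show "((\<lambda>t. (e t)\<^sup>2 * exp (- 2 * K * t)) has_real_derivative
        2 * (e u)\<^sup>2 * (k u - K) * exp (- 2 * K * u)) (at u within {0..})" if "s \<le> u" "u \<le> t" for u
      using assms that by (auto intro!: derivative_eq_intros e_deriv simp: k_def power2_eq_square algebra_simps)
    show "2 * (e u)\<^sup>2 * (k u - K) * exp (- 2 * K * u) \<le> 0" if "s < u" "u < t" for u
      using bspec[OF K, of u] that by (intro mult_nonpos_nonneg mult_nonneg_nonpos) auto
  qed (use assms in auto)
  then show ?thesis using assms(3) by (simp add: mult_le_0_iff)
qed

lemma w_stays_if_e_zero:
  assumes "0 \<le> s" "s \<le> t" "e s = 0" shows "w t = w s"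
proof (rule antisym)
  have z: "e u = 0" if "s < u" "u < t" for u
    using e_stays_zero[OF assms(1) _ assms(3), of u] that by simp
  show "w t \<le> w s"
    by (rule nonincreasing_on_segment[where f = w and f' = "\<lambda>t. 4 * \<rho> t * (e t)\<^sup>2 * \<bar>w t\<bar>"])
      (use assms z w_deriv in auto)
  show "w s \<le> w t"
    by (rule nondecreasing_on_segment[where f = w and f' = "\<lambda>t. 4 * \<rho> t * (e t)\<^sup>2 * \<bar>w t\<bar>"])
      (use assms z w_deriv in auto)
qed

lemma energy_conserved:
  assumes "A 0 \<le> a" "0 \<le> t" "w t < 0"
  shows "(e t)\<^sup>2 - barrier (w t) = (e 0)\<^sup>2 - barrier (w 0)"
proof -
  have der: "((\<lambda>t. (e t)\<^sup>2 - barrier (w t)) has_real_derivative 0) (at u within {0..})"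
    if "0 \<le> u" "u \<le> t" for u
  proof -
    \<comment> \<open>Monotonicity of w carries the sign back from time t to all earlier times, so
      the logarithm is differentiable on the whole segment.\<close>
    have "w u < 0" using w_mono[OF assms(1) that] assms(3) by simp
    note wu = w_deriv[OF that(1)]
    have sq: "((\<lambda>t. (w t)\<^sup>2) has_real_derivative
        2 * w u * (4 * \<rho> u * (e u)\<^sup>2 * \<bar>w u\<bar>)) (at u within {0..})"
      using DERIV_power[OF wu, of 2] by (simp add: mult_ac)
    have "((\<lambda>t. ln (- w t)) has_real_derivative
        1 / (- w u) * - (4 * \<rho> u * (e u)\<^sup>2 * \<bar>w u\<bar>)) (at u within {0..})"
      using \<open>w u < 0\<close> by (intro DERIV_chain2[OF DERIV_ln_divide] DERIV_minus wu) auto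
    then have "((\<lambda>t. ln (- w t)) has_real_derivative - (4 * \<rho> u * (e u)\<^sup>2)) (at u within {0..})"
      using \<open>w u < 0\<close> by simp
    note * = DERIV_diff[OF e_square_deriv[OF that(1)] DERIV_add[OF DERIV_diff[OF sq this] DERIV_const[of E_sad]]]
    show ?thesis
      unfolding barrier_def
      by (rule DERIV_cong[OF *]) (use \<open>w u < 0\<close> in \<open>simp add: algebra_simps power2_eq_square\<close>)
  qed
  show ?thesis
    using nondecreasing_on_segment[of 0 t "\<lambda>t. (e t)\<^sup>2 - barrier (w t)" "\<lambda>_. 0"]
      nonincreasing_on_segment[of 0 t "\<lambda>t. (e t)\<^sup>2 - barrier (w t)" "\<lambda>_. 0"] der assms(2)
    by auto
qed

section \<open>Type of the limit in terms of the initial point\<close>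

context
  fixes el wl :: real
  assumes el: "(e \<longlongrightarrow> el) at_top" and wl: "(w \<longlongrightarrow> wl) at_top"
    and crit: "el = 0 \<or> signal el wl = a"
begin

lemma A_tendsto: "(A \<longlongrightarrow> signal el wl) at_top"
  unfolding A_def signal_def by (intro tendsto_intros el wl)

text \<open>For w <= -1/sqrt 2 the signal is nonpositive and cannot equal a > 0, so criticality
  leaves only el = 0. Criticality is assumed in this context because a general speed might vanish
  for other reasons. The last claim is energy conservation in the limit.\<close>

lemma limit_below:
  assumes "\<And>t. 0 \<le> t \<Longrightarrow> w t \<le> - 1 / sqrt 2"
  shows "wl \<le> - 1 / sqrt 2" and "el = 0"
    and "A 0 \<le> a \<Longrightarrow> barrier wl = barrier (w 0) - (e 0)\<^sup>2"
proof -
  show *: "wl \<le> - 1 / sqrt 2"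
    by (rule tendsto_upperbound[OF wl]) (rule eventually_at_top_linorderI[of 0], rule assms, simp_all)
  then have "signal el wl \<le> 0"
    using one_plus_mult_abs_le_0_iff[of wl] by (simp add: signal_def mult_nonneg_nonpos)
  then show "el = 0" using crit a_pos by auto
  assume A0: "A 0 \<le> a"
  have neg: "w t < 0" if "0 \<le> t" for t using assms[OF that] neg_inv_sqrt2_less(1) by linarith
  have "wl < 0" using * neg_inv_sqrt2_less(1) by linarith
  then have "((\<lambda>t. (e t)\<^sup>2 - barrier (w t)) \<longlongrightarrow> el\<^sup>2 - barrier wl) at_top"
    unfolding barrier_def by (auto intro!: tendsto_intros el wl)
  moreover have "((\<lambda>t. (e t)\<^sup>2 - barrier (w t)) \<longlongrightarrow> (e 0)\<^sup>2 - barrier (w 0)) at_top"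
    by (rule tendsto_eventually) (auto intro!: eventually_at_top_linorderI[of 0] energy_conserved A0 neg)
  ultimately have "el\<^sup>2 - barrier wl = (e 0)\<^sup>2 - barrier (w 0)"
    by (rule tendsto_unique[rotated]) simp
  then show "barrier wl = barrier (w 0) - (e 0)\<^sup>2" using \<open>el = 0\<close> by simp
qed

lemma A_0_le: "w 0 \<le> - 1 / sqrt 2 \<Longrightarrow> A 0 \<le> a"
  using one_plus_mult_abs_le_0_iff[of "w 0"] a_pos
  by (auto simp: A_def signal_def intro: order_trans[OF mult_nonneg_nonpos])

text \<open>\<open>barrier\<close> vanishes at the threshold, so the energy of an orbit that gets
  there equals e^2 at that moment; its sign decides whether the passage is possible.\<close>

lemma crossing:
  assumes "w 0 \<le> - 1 / sqrt 2" "0 \<le> t" "- 1 / sqrt 2 \<le> w t"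
  shows "\<exists>T. 0 \<le> T \<and> T \<le> t \<and> w T = - 1 / sqrt 2 \<and> (e T)\<^sup>2 = (e 0)\<^sup>2 - barrier (w 0)"
proof -
  obtain T where T: "0 \<le> T" "T \<le> t" "w T = - 1 / sqrt 2"
    using IVT'[of w 0 "- 1 / sqrt 2" t] assms continuous_on_subset[OF cont_w, of "{0..t}"] by auto
  then have "w T < 0" using neg_inv_sqrt2_less(1) by simp
  then show ?thesis
    using energy_conserved[OF A_0_le[OF assms(1)] T(1)] barrier_eq_0_iff[of "w T"] T
    by (intro exI[of _ T]) simp
qed

text \<open>The energy is negative, so it cannot be a square at the threshold. The same sign gives
  barrier wl > 0, which keeps the limit strictly to the left.\<close>

lemma limit_I_min:
  assumes "(e 0, w 0) \<in> I_min"
  shows "el = 0" and "wl < - 1 / sqrt 2"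
proof -
  have 0: "w 0 < - 1 / sqrt 2" "(e 0)\<^sup>2 < barrier (w 0)"
    using assms by (auto simp: mem_I_min_iff)
  have below: "w t \<le> - 1 / sqrt 2" if t: "0 \<le> t" for t
  proof (rule ccontr)
    assume "\<not> ?thesis"
    then obtain T where "(e T)\<^sup>2 = (e 0)\<^sup>2 - barrier (w 0)"
      using crossing[OF less_imp_le[OF 0(1)] t] by auto
    then show False using 0 zero_le_power2[of "e T"] by linarith
  qed
  show "el = 0" by (rule limit_below(2)[OF below])
  have "barrier wl > 0" using limit_below(3)[OF below A_0_le] 0 by simp
  then have "wl \<noteq> - 1 / sqrt 2" using barrier_eq_0_iff[of wl] neg_inv_sqrt2_less(1) by auto
  then show "wl < - 1 / sqrt 2" using limit_below(1)[OF below] by simp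
qed

text \<open>The energy is zero, so a passage would take place at e = 0, an equilibrium that is never
  left; the limit then satisfies barrier wl = 0.\<close>

lemma limit_I_sad:
  assumes "(e 0, w 0) \<in> I_sad"
  shows "el = 0" and "wl = - 1 / sqrt 2"
proof -
  have 0: "w 0 \<le> - 1 / sqrt 2" "(e 0)\<^sup>2 = barrier (w 0)"
    using assms by (auto simp: mem_I_sad_iff)
  have below: "w t \<le> - 1 / sqrt 2" if t: "0 \<le> t" for t
  proof (rule ccontr)
    assume gt: "\<not> ?thesis"
    then obtain T where "0 \<le> T" "T \<le> t" "w T = - 1 / sqrt 2" "(e T)\<^sup>2 = 0"
      using crossing[OF 0(1) t] 0(2) by auto
    then show False using w_stays_if_e_zero[of T t] gt by simp
  qed
  show "el = 0" by (rule limit_below(2)[OF below])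
  have "wl < 0" using limit_below(1)[OF below] neg_inv_sqrt2_less(1) by linarith
  moreover have "barrier wl = 0" using limit_below(3)[OF below A_0_le] 0 by simp
  ultimately show "wl = - 1 / sqrt 2" using barrier_eq_0_iff[of wl] by simp
qed

lemma limit_I_max:
  assumes "(e 0, w 0) \<in> I_max"
  shows "el = 0" and "wl > - 1 / sqrt 2"
proof -
  have 0: "e 0 = 0" "- 1 / sqrt 2 < w 0" using assms by (auto simp: I_max_def)
  have "(e \<longlongrightarrow> 0) at_top"
    by (rule tendsto_eventually) (use e_stays_zero[of 0] 0 in \<open>auto intro!: eventually_at_top_linorderI[of 0]\<close>)
  then show "el = 0" using tendsto_unique[OF _ el] by simp
  have "(w \<longlongrightarrow> w 0) at_top"
    by (rule tendsto_eventually) (rule eventually_at_top_linorderI[of 0], rule w_stays_if_e_zero, simp_all add: 0)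
  then show "wl > - 1 / sqrt 2" using tendsto_unique[OF _ wl] 0 by simp
qed

text \<open>It suffices to exclude el = 0. Above the critical signal the limit still has signal at
  least a > 0. Below it, e^2 does not decrease once w >= -1/sqrt 2, and an orbit remaining on the
  left with positive energy would need barrier wl < 0.\<close>

lemma limit_generic:
  assumes "(e 0, w 0) \<notin> I_min \<union> I_sad \<union> I_max"
  shows "signal el wl = a"
proof -
  have "el \<noteq> 0"
  proof (cases "A 0 \<le> a")
    case False
    have "a \<le> signal el wl"
      by (rule tendsto_lowerbound[OF A_tendsto])
        (use A_ge False in \<open>auto intro!: eventually_at_top_linorderI[of 0]\<close>)
    then show ?thesis using a_pos by (auto simp: signal_def)
  next
    case A0: True
    have from_above: "el \<noteq> 0" if T: "0 \<le> T" "- 1 / sqrt 2 \<le> w T" "e T \<noteq> 0" for T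
    proof -
      have "(e T)\<^sup>2 \<le> el\<^sup>2"
        by (rule tendsto_lowerbound[OF tendsto_power[OF el]])
          (use e_square_mono[OF A0 T(1) _ T(2)] in \<open>auto intro!: eventually_at_top_linorderI[of T]\<close>)
      then show ?thesis using T(3) by auto
    qed
    show ?thesis
    proof (cases "- 1 / sqrt 2 \<le> w 0")
      case True
      have "e 0 \<noteq> 0"
      proof
        assume "e 0 = 0"
        then have "(e 0, w 0) \<in> I_sad \<union> I_max"
          using True barrier_eq_0_iff[of "w 0"] neg_inv_sqrt2_less(1)
          by (cases "w 0 = - 1 / sqrt 2") (auto simp: mem_I_sad_iff I_max_def)
        then show False using assms by blast
      qed
      then show ?thesis using from_above[of 0] True by simp
    next
      case False
      then have w0: "w 0 \<le> - 1 / sqrt 2" "w 0 < - 1 / sqrt 2" by simp_all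
      then have e0: "barrier (w 0) < (e 0)\<^sup>2"
        using assms by (auto simp: mem_I_min_iff mem_I_sad_iff)
      show ?thesis
      proof (cases "\<exists>t\<ge>0. - 1 / sqrt 2 \<le> w t")
        case True
        then obtain T where T: "0 \<le> T" "w T = - 1 / sqrt 2" "(e T)\<^sup>2 = (e 0)\<^sup>2 - barrier (w 0)"
          using crossing[OF w0(1)] by blast
        then have "e T \<noteq> 0" using e0 by auto
        then show ?thesis using from_above[of T] T by simp
      next
        case False
        then have below: "w t \<le> - 1 / sqrt 2" if "0 \<le> t" for t using that by (meson le_cases)
        have "barrier wl < 0" using limit_below(3)[OF below A0] e0 by simp
        then show ?thesis
          using barrier_nonneg[of wl] limit_below(1)[OF below] neg_inv_sqrt2_less(1) by linarith
      qed
    qed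
  qed
  then show ?thesis using crit by simp
qed

end

end

section \<open>The loss as a function of the signal\<close>

lemma (in binary_markov_chain) x_measurable [measurable]:
  "n \<ge> 1 \<Longrightarrow> x n \<in> measurable M (count_space UNIV)"
  using measurable_compose[OF random_variable_x, of n "\<lambda>y. y" "count_space UNIV"] by simp

lemma (in binary_markov_chain) x_range:
  "n \<ge> 1 \<Longrightarrow> \<omega> \<in> space M \<Longrightarrow> x n \<omega> = 0 \<or> x n \<omega> = 1"
  using measurable_space[OF random_variable_x] by force

lemma (in binary_markov_chain) prob_split_next:
  assumes [measurable]: "Measurable.pred M P" and n: "n \<ge> 1"
  shows "\<P>(\<omega> in M. P \<omega>) = \<P>(\<omega> in M. x n \<omega> = 0 \<and> P \<omega>) + \<P>(\<omega> in M. x n \<omega> = 1 \<and> P \<omega>)"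
proof -
  have [measurable]: "x n \<in> measurable M (count_space UNIV)" using n by (rule x_measurable)
  have "{\<omega> \<in> space M. P \<omega>} = {\<omega> \<in> space M. x n \<omega> = 0 \<and> P \<omega>} \<union> {\<omega> \<in> space M. x n \<omega> = 1 \<and> P \<omega>}"
    using x_range[OF n] by blast
  then show ?thesis by (subst finite_measure_Union[symmetric]) auto
qed

text \<open>Positive marginals allow the conditional probabilities to be multiplied out; the other
  two joint probabilities are complements.\<close>

lemma (in binary_markov_chain) transition_probs:
  assumes n: "n \<ge> 1" and 0: "\<P>(\<omega> in M. x n \<omega> = 0) > 0" and 1: "\<P>(\<omega> in M. x n \<omega> = 1) > 0"
  shows "\<P>(\<omega> in M. x n \<omega> = 0 \<and> x (n + 1) \<omega> = 1) = p * \<P>(\<omega> in M. x n \<omega> = 0)"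
    and "\<P>(\<omega> in M. x n \<omega> = 1 \<and> x (n + 1) \<omega> = 0) = q * \<P>(\<omega> in M. x n \<omega> = 1)"
    and "\<P>(\<omega> in M. x n \<omega> = 0 \<and> x (n + 1) \<omega> = 0) = (1 - p) * \<P>(\<omega> in M. x n \<omega> = 0)"
    and "\<P>(\<omega> in M. x n \<omega> = 1 \<and> x (n + 1) \<omega> = 1) = (1 - q) * \<P>(\<omega> in M. x n \<omega> = 1)"
proof -
  have [measurable]: "x n \<in> measurable M (count_space UNIV)"
      "x (n + 1) \<in> measurable M (count_space UNIV)"
    using n by (auto intro: x_measurable)
  show a: "\<P>(\<omega> in M. x n \<omega> = 0 \<and> x (n + 1) \<omega> = 1) = p * \<P>(\<omega> in M. x n \<omega> = 0)"
    using transition_01[OF n] 0 by (simp add: cond_prob_def field_simps conj_commute)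
  show b: "\<P>(\<omega> in M. x n \<omega> = 1 \<and> x (n + 1) \<omega> = 0) = q * \<P>(\<omega> in M. x n \<omega> = 1)"
    using transition_10[OF n] 1 by (simp add: cond_prob_def field_simps conj_commute)
  show "\<P>(\<omega> in M. x n \<omega> = 0 \<and> x (n + 1) \<omega> = 0) = (1 - p) * \<P>(\<omega> in M. x n \<omega> = 0)"
    using a prob_split_next[of "\<lambda>\<omega>. x n \<omega> = 0" "n + 1"]
    by (simp add: algebra_simps conj_commute)
  show "\<P>(\<omega> in M. x n \<omega> = 1 \<and> x (n + 1) \<omega> = 1) = (1 - q) * \<P>(\<omega> in M. x n \<omega> = 1)"
    using b prob_split_next[of "\<lambda>\<omega>. x n \<omega> = 1" "n + 1"]
    by (simp add: algebra_simps conj_commute)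
qed

lemma (in binary_markov_chain) stationary:
  assumes "0 < p" "0 < q" "n \<ge> 1"
  shows "\<P>(\<omega> in M. x n \<omega> = 0) = q / (p + q) \<and> \<P>(\<omega> in M. x n \<omega> = 1) = p / (p + q)"
  using assms(3)
proof (induction n rule: dec_induct)
  case base
  then show ?case using initial_0 initial_1 by simp
next
  case (step n)
  then have n: "n \<ge> 1" by simp
  have [measurable]: "x n \<in> measurable M (count_space UNIV)"
      "x (n + 1) \<in> measurable M (count_space UNIV)"
    using n by (auto intro: x_measurable)
  let ?Q = "\<lambda>i j. \<P>(\<omega> in M. x n \<omega> = i \<and> x (n + 1) \<omega> = j)"
  have IH: "\<P>(\<omega> in M. x n \<omega> = 0) = q / (p + q)" "\<P>(\<omega> in M. x n \<omega> = 1) = p / (p + q)"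
    using step.IH by auto
  have pos: "\<P>(\<omega> in M. x n \<omega> = 0) > 0" "\<P>(\<omega> in M. x n \<omega> = 1) > 0"
    unfolding IH using assms by simp_all
  note t = transition_probs[OF n pos, unfolded IH]
  have "\<P>(\<omega> in M. x (n + 1) \<omega> = 0) = ?Q 0 0 + ?Q 1 0" "\<P>(\<omega> in M. x (n + 1) \<omega> = 1) = ?Q 0 1 + ?Q 1 1"
    by (rule prob_split_next[OF _ n], measurable)+
  then show ?case
    unfolding t by (simp add: algebra_simps flip: add_divide_distrib)
qed

lemma (in binary_markov_chain) expectation_pair:
  fixes f :: "nat \<Rightarrow> nat \<Rightarrow> real"
  assumes "0 < p" "0 < q" and n: "n \<ge> 1"
  shows "(\<integral>\<omega>. f (x n \<omega>) (x (n + 1) \<omega>) \<partial>M) =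
    q / (p + q) * ((1 - p) * f 0 0 + p * f 0 1) + p / (p + q) * (q * f 1 0 + (1 - q) * f 1 1)"
proof -
  have [measurable]: "x n \<in> measurable M (count_space UNIV)"
      "x (n + 1) \<in> measurable M (count_space UNIV)"
    using n by (auto intro: x_measurable)
  define S where "S i j = {\<omega> \<in> space M. x n \<omega> = i \<and> x (n + 1) \<omega> = j}" for i j
  have [measurable]: "S i j \<in> sets M" for i j
    unfolding S_def by measurable
  have [simp]: "integrable M (indicator (S i j) :: _ \<Rightarrow> real)" for i j
    by (intro integrable_real_indicator) (auto simp: less_top[symmetric])
  have [simp]: "S i j \<inter> space M = S i j" for i j
    by (auto simp: S_def)
  have "(\<integral>\<omega>. f (x n \<omega>) (x (n + 1) \<omega>) \<partial>M) =
    (\<integral>\<omega>. f 0 0 * indicator (S 0 0) \<omega> + f 0 1 * indicator (S 0 1) \<omega> +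
      f 1 0 * indicator (S 1 0) \<omega> + f 1 1 * indicator (S 1 1) \<omega> \<partial>M)"
  proof (rule Bochner_Integration.integral_cong)
    fix \<omega> assume "\<omega> \<in> space M"
    then show "f (x n \<omega>) (x (n + 1) \<omega>) = f 0 0 * indicator (S 0 0) \<omega> + f 0 1 * indicator (S 0 1) \<omega> +
      f 1 0 * indicator (S 1 0) \<omega> + f 1 1 * indicator (S 1 1) \<omega>"
      using x_range[OF n, of \<omega>] x_range[of "n + 1" \<omega>] by (auto simp: S_def)
  qed simp
  also have "\<dots> = f 0 0 * prob (S 0 0) + f 0 1 * prob (S 0 1) +
      f 1 0 * prob (S 1 0) + f 1 1 * prob (S 1 1)"
    by simp
  also have "\<dots> = q / (p + q) * ((1 - p) * f 0 0 + p * f 0 1) + p / (p + q) * (q * f 1 0 + (1 - q) * f 1 1)"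
  proof -
    have pi: "\<P>(\<omega> in M. x n \<omega> = 0) = q / (p + q)" "\<P>(\<omega> in M. x n \<omega> = 1) = p / (p + q)"
      using stationary[OF assms] by auto
    have "\<P>(\<omega> in M. x n \<omega> = 0) > 0" "\<P>(\<omega> in M. x n \<omega> = 1) > 0"
      unfolding pi using assms by simp_all
    note t = transition_probs[OF n this, unfolded pi]
    show ?thesis
      unfolding S_def t by (simp add: algebra_simps del: times_divide_eq_left times_divide_eq_right)
  qed
  finally show ?thesis .
qed

text \<open>Here c is the bias with the shift e^2 / 2 absorbed, so minimising over b and over c is
  the same. N disappears because all consecutive pairs have the same law.\<close>

definition population_loss :: "real \<Rightarrow> real \<Rightarrow> real \<Rightarrow> real \<Rightarrow> real" where
  "population_loss p q a c =
     q / (p + q) * ((1 - p) * logistic_loss (- c) + p * logistic_loss c) +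
     p / (p + q) * (q * logistic_loss (- (a + c)) + (1 - q) * logistic_loss (a + c))"

lemma (in binary_markov_chain) bias_loss_eq:
  assumes "0 < p" "0 < q" "N \<ge> 1"
  shows "bias_loss M x N (e, w) b = population_loss p q (signal e w) (b - e\<^sup>2 / 2)"
proof -
  define f where "f i j = logistic_loss ((2 * real j - 1) *
       (e\<^sup>2 * (1 + 2 * w * \<bar>w\<bar>) * real i + b - e\<^sup>2 / 2))" for i j
  have "(\<integral>\<omega>. f (x n \<omega>) (x (n + 1) \<omega>) \<partial>M) = population_loss p q (signal e w) (b - e\<^sup>2 / 2)"
    if "n \<ge> 1" for n
    unfolding expectation_pair[OF assms(1,2) that]
    by (simp add: f_def population_loss_def signal_def algebra_simps)
  then have "(\<Sum>n=1..N. \<integral>\<omega>. f (x n \<omega>) (x (n + 1) \<omega>) \<partial>M) =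
      (\<Sum>n=1..N. population_loss p q (signal e w) (b - e\<^sup>2 / 2))"
    by (intro sum.cong) auto
  then show ?thesis using assms(3) by (simp add: bias_loss_def f_def)
qed

section \<open>Calculus of the logistic loss\<close>

definition sigmoid :: "real \<Rightarrow> real" where
  "sigmoid z = exp z / (1 + exp z)"

lemma sigmoid_deriv: "(sigmoid has_real_derivative sigmoid z * (1 - sigmoid z)) (at z)"
proof -
  have "1 + exp z \<noteq> 0" "exp z + 1 \<noteq> 0" using exp_gt_zero[of z] by linarith+
  then show ?thesis
    unfolding sigmoid_def
    by (auto intro!: derivative_eq_intros simp: field_simps)
qed

lemma sigmoid_pos: "0 < sigmoid z" and sigmoid_less_1: "sigmoid z < 1"
  by (simp_all add: sigmoid_def add_pos_pos)

lemma sigmoid_strict_mono: "x < y \<Longrightarrow> sigmoid x < sigmoid y"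
  by (rule DERIV_pos_imp_increasing[of x y sigmoid])
    (auto intro!: exI sigmoid_deriv simp: sigmoid_pos sigmoid_less_1)

lemma sigmoid_ln_odds:
  assumes "0 < s" "s < 1" shows "sigmoid (ln (s / (1 - s))) = s"
  using assms by (simp add: sigmoid_def divide_simps)

lemma logistic_loss_deriv: "(logistic_loss has_real_derivative sigmoid z - 1) (at z)"
proof -
  have pos: "1 + exp (- z) > 0" by (simp add: add_pos_pos)
  have "exp z + 1 \<noteq> 0" using exp_gt_zero[of z] by linarith
  then have "- exp (- z) / (1 + exp (- z)) = sigmoid z - 1"
    by (simp add: sigmoid_def exp_minus field_simps)
  with pos show ?thesis
    unfolding logistic_loss_def[abs_def] by (auto intro!: derivative_eq_intros)
qed

lemma sigmoid_minus: "sigmoid (- z) = 1 - sigmoid z"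
proof -
  have "exp z + 1 \<noteq> 0" using exp_gt_zero[of z] by linarith
  then show ?thesis by (simp add: sigmoid_def exp_minus field_simps)
qed

section \<open>Optimal bias and minimised loss\<close>

locale transition_pair =
  fixes p q :: real
  assumes pq: "0 < p" "0 < q" "p < 1" "q < 1" "p + q < 1"
begin

definition r where "r = p / (p + q)"

text \<open>The fourth fact is invariance of the stationary mass r of state 1; it turns the constant
  terms of the derivative in the bias into - r.\<close>

lemma r: "0 < r" "r < 1" "q / (p + q) = 1 - r" "(1 - r) * p + r * (1 - q) = r"
  using pq by (auto simp: r_def divide_simps) (simp add: algebra_simps)

text \<open>Signal and bias vary together, with the derivative of their sum as a separate datum:
  this form serves both the derivative in the bias alone and the envelope formula.\<close>

lemma population_loss_deriv:
  assumes c: "(c has_real_derivative c') (at t)" and d: "((\<lambda>t. a t + c t) has_real_derivative d') (at t)"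
  shows "((\<lambda>t. population_loss p q (a t) (c t)) has_real_derivative
    (1 - r) * (sigmoid (c t) - p) * c' + r * (sigmoid (a t + c t) - (1 - q)) * d') (at t)"
proof -
  note comp = DERIV_chain2[OF logistic_loss_deriv]
  have "((\<lambda>t. population_loss p q (a t) (c t)) has_real_derivative
    (1 - r) * ((1 - p) * ((sigmoid (- c t) - 1) * - c') + p * ((sigmoid (c t) - 1) * c')) +
    r * (q * ((sigmoid (- (a t + c t)) - 1) * - d') + (1 - q) * ((sigmoid (a t + c t) - 1) * d'))) (at t)"
    unfolding population_loss_def r(3) r_def[symmetric]
    by (intro DERIV_add DERIV_cmult comp DERIV_minus c d)
  then show ?thesis
    by (rule DERIV_cong) (simp only: sigmoid_minus, simp add: algebra_simps)
qed

text \<open>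
  With \<open>y = exp c\<close>, stationarity of the loss in the bias is the quadratic equation
  \<open>(1 - r) exp a y\<^sup>2 + (1 - 2 r) y - r = 0\<close>; \<open>discr a\<close> is the root of its discriminant.
\<close>

definition discr where "discr a = sqrt ((1 - 2 * r)\<^sup>2 + 4 * r * (1 - r) * exp a)"

text \<open>The logarithm of the positive root of the quadratic, in rationalised form: numerator and
  denominator are both positive, so the logarithm of the quotient splits.\<close>

definition bias where "bias a = ln (2 * r / (1 - 2 * r + discr a))"

lemma discr_sq: "(discr a)\<^sup>2 = (1 - 2 * r)\<^sup>2 + 4 * r * (1 - r) * exp a"
  using r by (simp add: discr_def)

lemma discr_gt: "\<bar>1 - 2 * r\<bar> < discr a"
proof -
  have "sqrt ((1 - 2 * r)\<^sup>2) < discr a"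
    unfolding discr_def using r by (intro real_sqrt_less_mono) simp
  then show ?thesis by simp
qed

lemma bias_stationary: "(1 - r) * sigmoid (bias a) + r * sigmoid (a + bias a) = r"
proof -
  define u where "u = 1 - 2 * r + discr a"
  define y where "y = 2 * r / u"
  have u: "u > 0" using discr_gt[of a] by (simp add: u_def)
  have y: "y > 0" "exp (bias a) = y" using u r by (simp_all add: y_def bias_def u_def[symmetric])
  have "u\<^sup>2 = 4 * r * (1 - r) * exp a + 2 * (1 - 2 * r) * u"
    using discr_sq[of a] by (simp add: u_def power2_eq_square algebra_simps)
  then have "r * u\<^sup>2 = r * (4 * r * (1 - r) * exp a + 2 * (1 - 2 * r) * u)" by simp
  then have "(1 - r) * exp a * y\<^sup>2 + (1 - 2 * r) * y - r = 0"
  proof -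
    have yu: "y * u = 2 * r" using u by (simp add: y_def)
    \<comment> \<open>Multiplication by u^2 lets y enter only through y u = 2 r, which removes the
      quotient.\<close>
    have "u\<^sup>2 * ((1 - r) * exp a * y\<^sup>2 + (1 - 2 * r) * y - r) =
        (1 - r) * exp a * (y * u)\<^sup>2 + (1 - 2 * r) * (y * u) * u - r * u\<^sup>2"
      by (simp add: power2_eq_square algebra_simps)
    also have "\<dots> = 0"
      unfolding yu \<open>r * u\<^sup>2 = _\<close> by (simp add: power2_eq_square algebra_simps)
    finally show ?thesis using u by simp
  qed
  moreover have "1 + y > 0" "1 + exp a * y > 0" using y by (simp_all add: add_pos_pos)
  ultimately show ?thesis
    by (simp add: sigmoid_def exp_add y divide_simps) (simp add: algebra_simps power2_eq_square)
qed

lemma stationary_strict_mono: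
  "c < d \<Longrightarrow> (1 - r) * sigmoid c + r * sigmoid (a + c) < (1 - r) * sigmoid d + r * sigmoid (a + d)"
  using r sigmoid_strict_mono[of c d] sigmoid_strict_mono[of "a + c" "a + d"]
  by (intro add_strict_mono[OF mult_strict_left_mono mult_strict_left_mono]) auto

lemma bias_unique:
  assumes "(1 - r) * sigmoid c + r * sigmoid (a + c) = r" shows "bias a = c"
  using stationary_strict_mono[of c "bias a" a] stationary_strict_mono[of "bias a" c a]
    bias_stationary[of a] assms by (cases c "bias a" rule: linorder_cases) auto

lemma population_loss_deriv_bias:
  "(population_loss p q a has_real_derivative ((1 - r) * sigmoid c + r * sigmoid (a + c) - r)) (at c)"
proof -
  have "((\<lambda>c. a + c) has_real_derivative 1) (at c)" by (auto intro!: derivative_eq_intros)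
  have "((\<lambda>c. population_loss p q a c) has_real_derivative
      (1 - r) * (sigmoid c - p) * 1 + r * (sigmoid (a + c) - (1 - q)) * 1) (at c)"
    by (rule population_loss_deriv[OF DERIV_ident \<open>((\<lambda>c. a + c) has_real_derivative 1) (at c)\<close>])
  then show ?thesis
    by (rule DERIV_cong) (use r(4) in \<open>simp add: algebra_simps\<close>)
qed

text \<open>The derivative in c is strictly increasing and vanishes at
  \<open>bias a\<close>.\<close>

lemma population_loss_bias_le: "population_loss p q a (bias a) \<le> population_loss p q a c"
proof (cases "bias a \<le> c")
  case True
  then show ?thesis
  proof (rule DERIV_nonneg_imp_nondecreasing)
    fix t assume "bias a \<le> t"
    then show "\<exists>y. (population_loss p q a has_real_derivative y) (at t) \<and> 0 \<le> y"
      using stationary_strict_mono[of "bias a" t a] bias_stationary[of a] population_loss_deriv_bias[of a t]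
      by (cases "bias a = t") fastforce+
  qed
next
  case False
  then have "c \<le> bias a" by simp
  then show ?thesis
  proof (rule DERIV_nonpos_imp_nonincreasing)
    fix t assume "t \<le> bias a"
    then show "\<exists>y. (population_loss p q a has_real_derivative y) (at t) \<and> y \<le> 0"
      using stationary_strict_mono[of t "bias a" a] bias_stationary[of a] population_loss_deriv_bias[of a t]
      by (cases "bias a = t") fastforce+
  qed
qed

text \<open>Minus the derivative of the minimised loss in the signal
  (\<open>min_loss_deriv\<close>), hence the force on the signal.\<close>

definition drive where "drive a = r * (1 - q - sigmoid (a + bias a))"

lemma bias_plus_deriv:
  "((\<lambda>a. a + bias a) has_real_derivative 1 / 2 + (1 - 2 * r) / (2 * discr a)) (at a)"
proof -
  define d where "d = discr a"
  have pos: "(1 - 2 * r)\<^sup>2 + 4 * r * (1 - r) * exp a > 0"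
    using r by (intro add_nonneg_pos) auto
  have d: "d > 0" "1 - 2 * r + d > 0" using discr_gt[of a] by (auto simp: d_def)
  have "(discr has_real_derivative 4 * r * (1 - r) * exp a / (2 * d)) (at a)"
    unfolding discr_def[abs_def] d_def
    by (rule derivative_eq_intros refl pos | use pos in \<open>simp add: divide_simps\<close>)+
  \<comment> \<open>\<open>discr_sq\<close> eliminates exp a; the numerator then factors and cancels
    against 1 - 2 r + d.\<close>
  then have dd: "(discr has_real_derivative (d\<^sup>2 - (1 - 2 * r)\<^sup>2) / (2 * d)) (at a)"
    using discr_sq[of a] by (simp add: d_def)
  have "((\<lambda>a. a + (ln (2 * r) - ln (1 - 2 * r + discr a))) has_real_derivative
    1 + (0 - 1 / (1 - 2 * r + d) * (0 + (d\<^sup>2 - (1 - 2 * r)\<^sup>2) / (2 * d)))) (at a)"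
    unfolding d_def
    using d by (intro DERIV_add DERIV_diff DERIV_chain2[OF DERIV_ln_divide] DERIV_const DERIV_ident
        dd[unfolded d_def]) (simp add: d_def)
  moreover have "(\<lambda>a. a + (ln (2 * r) - ln (1 - 2 * r + discr a))) = (\<lambda>a. a + bias a)"
  proof
    fix a show "a + (ln (2 * r) - ln (1 - 2 * r + discr a)) = a + bias a"
      using discr_gt[of a] r by (simp add: bias_def ln_div)
  qed
  moreover have "1 + (0 - 1 / (1 - 2 * r + d) * (0 + (d\<^sup>2 - (1 - 2 * r)\<^sup>2) / (2 * d)))
      = 1 / 2 + (1 - 2 * r) / (2 * d)"
  proof -
    have "d\<^sup>2 - (1 - 2 * r)\<^sup>2 = (1 - 2 * r + d) * (d - (1 - 2 * r))"
      by (simp add: power2_eq_square algebra_simps)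
    then have "1 / (1 - 2 * r + d) * (0 + (d\<^sup>2 - (1 - 2 * r)\<^sup>2) / (2 * d)) = (d - (1 - 2 * r)) / (2 * d)"
      using d by simp
    also have "\<dots> = 1 / 2 - (1 - 2 * r) / (2 * d)"
      using d by (simp add: diff_divide_distrib)
    finally show ?thesis by simp
  qed
  ultimately show ?thesis by (simp add: d_def)
qed

text \<open>Both follow from |1 - 2 r| < discr a. The lower bound makes \<open>drive\<close>
  strictly decreasing, the upper one helps give it Lipschitz constant 1.\<close>

lemma bias_plus_deriv_bounds:
  "0 < 1 / 2 + (1 - 2 * r) / (2 * discr a)" "1 / 2 + (1 - 2 * r) / (2 * discr a) < 1"
  using discr_gt[of a] by (auto simp: divide_simps abs_less_iff)

lemma drive_deriv:
  "(drive has_real_derivative - (r * (sigmoid (a + bias a) * (1 - sigmoid (a + bias a)) *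
    (1 / 2 + (1 - 2 * r) / (2 * discr a))))) (at a)"
proof -
  have "(drive has_real_derivative r * (0 - sigmoid (a + bias a) * (1 - sigmoid (a + bias a)) *
    (1 / 2 + (1 - 2 * r) / (2 * discr a)))) (at a)"
    unfolding drive_def[abs_def]
    by (intro DERIV_cmult DERIV_diff DERIV_const DERIV_chain2[OF sigmoid_deriv] bias_plus_deriv)
  then show ?thesis by simp
qed

lemma drive_deriv_bounds:
  "0 < r * (sigmoid s * (1 - sigmoid s) * (1 / 2 + (1 - 2 * r) / (2 * discr a)))" (is "0 < ?v")
  "r * (sigmoid s * (1 - sigmoid s) * (1 / 2 + (1 - 2 * r) / (2 * discr a))) \<le> 1"
proof -
  show "0 < ?v"
    using r sigmoid_pos[of s] sigmoid_less_1[of s] bias_plus_deriv_bounds[of a]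
    by (intro mult_pos_pos) auto
  have "?v \<le> 1 * (1 * 1 * 1)"
    using r sigmoid_pos[of s] sigmoid_less_1[of s] bias_plus_deriv_bounds[of a]
    by (intro mult_mono mult_nonneg_nonneg) auto
  then show "?v \<le> 1" by simp
qed

lemma drive_strict_antimono: "a < b \<Longrightarrow> drive b < drive a"
  by (rule DERIV_neg_imp_decreasing[of a b drive])
    (auto intro!: exI drive_deriv simp: drive_deriv_bounds(1))

lemma drive_lipschitz: "1-lipschitz_on UNIV drive"
proof (rule lipschitz_onI)
  fix a b :: real
  have "norm (drive a - drive b) \<le> 1 * norm (a - b)"
  proof (rule field_differentiable_bound[OF convex_UNIV])
    fix t show "(drive has_real_derivative - (r * (sigmoid (t + bias t) * (1 - sigmoid (t + bias t)) *
        (1 / 2 + (1 - 2 * r) / (2 * discr t))))) (at t within UNIV)"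
      using drive_deriv by simp
    show "norm (- (r * (sigmoid (t + bias t) * (1 - sigmoid (t + bias t)) *
        (1 / 2 + (1 - 2 * r) / (2 * discr t))))) \<le> 1"
      using drive_deriv_bounds[of "t + bias t" t] by simp
  qed auto
  then show "dist (drive a) (drive b) \<le> 1 * dist a b" by (simp add: dist_norm)
qed simp

text \<open>The log-odds of a 1 after a 1 minus those of a 1 after a 0: with this signal and the
  bias ln (p / (1 - p)) both transition probabilities are reproduced exactly.\<close>

definition optimum where "optimum = ln ((1 - q) / q) - ln (p / (1 - p))"

text \<open>The condition p + q < 1 is equivalent to p q < (1 - p)(1 - q): the odds of a 1 are
  higher after a 1 than after a 0.\<close>

lemma optimum_pos: "0 < optimum"
proof -
  have "p * q < (1 - q) * (1 - p)" using pq by (simp add: algebra_simps)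
  then have "p / (1 - p) < (1 - q) / q" using pq by (simp add: divide_simps)
  then show ?thesis using pq by (simp add: optimum_def)
qed

lemma drive_optimum: "drive optimum = 0"
proof -
  have s: "sigmoid (optimum + ln (p / (1 - p))) = 1 - q"
    using sigmoid_ln_odds[of "1 - q"] pq by (simp add: optimum_def)
  have "bias optimum = ln (p / (1 - p))"
    by (rule bias_unique) (use s r(4) sigmoid_ln_odds[of p] pq in simp)
  then show ?thesis using s by (simp add: drive_def)
qed

definition min_loss where "min_loss a = population_loss p q a (bias a)"

text \<open>The envelope theorem: the variation of the optimal bias does not contribute.\<close>

lemma min_loss_deriv: "(min_loss has_real_derivative - drive a) (at a)"
proof -
  define d where "d = 1 / 2 + (1 - 2 * r) / (2 * discr a)"
  have d: "((\<lambda>a. a + bias a) has_real_derivative d) (at a)"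
    unfolding d_def by (rule bias_plus_deriv)
  have b: "(bias has_real_derivative d - 1) (at a)"
    using DERIV_diff[OF d DERIV_ident] by simp
  have "(1 - r) * (sigmoid (bias a) - p) = r * (1 - q - sigmoid (a + bias a))"
    using bias_stationary[of a] r(4) by (simp add: algebra_simps)
  then have "(1 - r) * (sigmoid (bias a) - p) * (d - 1) + r * (sigmoid (a + bias a) - (1 - q)) * d = - drive a"
    by (simp only:) (simp add: drive_def algebra_simps)
  then show ?thesis
    using population_loss_deriv[OF b d] by (simp add: min_loss_def[abs_def])
qed

end

text \<open>\<open>ARG_MIN\<close> picks some minimiser; exhibiting one determines the value
  there.\<close>

lemma (in binary_markov_chain) loss_eq:
  assumes "transition_pair p q" "N \<ge> 1"
  shows "loss M x N (e, w) = transition_pair.min_loss p q (signal e w)"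
proof -
  interpret transition_pair p q by fact
  let ?b = "bias (signal e w) + e\<^sup>2 / 2"
  have "bias_loss M x N (e, w) ?b \<le> bias_loss M x N (e, w) b" for b
    unfolding bias_loss_eq[OF pq(1,2) assms(2)]
    using population_loss_bias_le[of "signal e w" "b - e\<^sup>2 / 2"] by simp
  then have "loss M x N (e, w) = bias_loss M x N (e, w) ?b"
    unfolding loss_def optimal_bias_def by (intro arg_min_equality) auto
  then show ?thesis
    by (simp add: bias_loss_eq[OF pq(1,2) assms(2)] min_loss_def)
qed

section \<open>Critical points and convergence\<close>

lemma gradient_eqI:
  assumes "GDERIV f x :> D" shows "gradient f x = D"
  unfolding gradient_def
proof (rule the_equality[where P = "\<lambda>D. GDERIV f x :> D", OF assms])
  fix E assume "GDERIV f x :> E"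
  then have "(\<lambda>h. inner h E) = (\<lambda>h. inner h D)"
    using assms unfolding gderiv_def by (rule has_derivative_unique)
  then show "E = D" by (metis vector_eq_ldot)
qed

lemma critical_point_iff_gradient:
  assumes "GDERIV f x :> D" shows "critical_point f x \<longleftrightarrow> D = 0"
  unfolding critical_point_def using assms gradient_eqI[of f x 0] gradient_eqI[OF assms] by auto

lemma signal_gderiv:
  "GDERIV (\<lambda>\<theta>. signal (fst \<theta>) (snd \<theta>)) (e, w) :>
    (2 * e * (1 + 2 * w * \<bar>w\<bar>), 4 * e\<^sup>2 * \<bar>w\<bar>)"
proof -
  define k where "k \<theta> = snd \<theta> * \<bar>snd \<theta>\<bar>" for \<theta> :: "real \<times> real"
  have k: "(k has_derivative (\<lambda>h. snd h * (2 * \<bar>w\<bar>))) (at (e, w))"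
    unfolding k_def[abs_def]
    using DERIV_compose_FDERIV[where g = snd, OF _ has_derivative_snd[OF has_derivative_ident]]
      DERIV_mult_abs_self[of w] by fastforce
  have "((\<lambda>\<theta>. (fst \<theta>)\<^sup>2 * (1 + 2 * k \<theta>)) has_derivative
      (\<lambda>h. inner h (2 * e * (1 + 2 * w * \<bar>w\<bar>), 4 * e\<^sup>2 * \<bar>w\<bar>))) (at (e, w))"
    by (rule derivative_eq_intros k refl | simp)+
      (auto simp: k_def fun_eq_iff algebra_simps power2_eq_square)
  then show ?thesis by (simp add: gderiv_def signal_def k_def mult.assoc)
qed

lemma tendsto_signal:
  "(f \<longlongrightarrow> e) F \<Longrightarrow> (h \<longlongrightarrow> w) F \<Longrightarrow> ((\<lambda>t. signal (f t) (h t)) \<longlongrightarrow> signal e w) F"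
  unfolding signal_def by (intro tendsto_intros)

lemma signal_zero [simp]: "signal 0 w = 0"
  by (simp add: signal_def)

text \<open>What the landscape and the flow require of the minimised loss \<Phi>: minus its
  derivative \<psi> decreases strictly through 0 at a > 0. The Lipschitz bound supports the
  existence of trajectories.\<close>

locale signal_loss =
  fixes L :: "real \<times> real \<Rightarrow> real" and \<Phi> \<psi> :: "real \<Rightarrow> real" and a :: real
  assumes L_eq: "L (e, w) = \<Phi> (signal e w)"
    and \<Phi>_deriv: "(\<Phi> has_real_derivative - \<psi> u) (at u)"
    and \<psi>_less: "u < v \<Longrightarrow> \<psi> v < \<psi> u"
    and \<psi>_lip: "1-lipschitz_on UNIV \<psi>"
    and a_pos: "a > 0"
    and \<psi>_a: "\<psi> a = 0"
begin

lemma \<psi>_pos: "u < a \<Longrightarrow> 0 < \<psi> u" and \<psi>_neg: "a < u \<Longrightarrow> \<psi> u < 0"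
  using \<psi>_less[of u a] \<psi>_less[of a u] \<psi>_a by auto

lemma \<psi>_eq_0_iff: "\<psi> u = 0 \<longleftrightarrow> u = a"
  using \<psi>_pos[of u] \<psi>_neg[of u] \<psi>_a by (cases u a rule: linorder_cases) auto

lemma cont_\<psi>: "continuous_on S \<psi>"
  using lipschitz_on_continuous_on[OF \<psi>_lip] continuous_on_subset by blast

lemma \<Phi>_cont: "continuous_on S \<Phi>"
  using \<Phi>_deriv by (intro DERIV_continuous_on) (blast intro: has_field_derivative_at_within)

lemma \<Phi>_less: "u < v \<Longrightarrow> v \<le> a \<Longrightarrow> \<Phi> v < \<Phi> u"
  by (rule DERIV_neg_imp_decreasing_open[of u v \<Phi>])
    (auto intro!: exI \<Phi>_deriv \<Phi>_cont \<psi>_pos)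

lemma \<Phi>_less': "u < v \<Longrightarrow> a \<le> u \<Longrightarrow> \<Phi> u < \<Phi> v"
  by (rule DERIV_pos_imp_increasing_open[of u v \<Phi>])
    (auto intro!: exI \<Phi>_deriv \<Phi>_cont \<psi>_neg)

lemma \<Phi>_min: "\<Phi> a \<le> \<Phi> u"
  using \<Phi>_less[of u a] \<Phi>_less'[of a u] by (cases u a rule: linorder_cases) auto

lemma L_eq': "L = (\<lambda>\<theta>. \<Phi> (signal (fst \<theta>) (snd \<theta>)))"
  using L_eq by auto

lemma L_gderiv: "GDERIV L (e, w) :>
    (- \<psi> (signal e w) * (2 * e * (1 + 2 * w * \<bar>w\<bar>)), - \<psi> (signal e w) * (4 * e\<^sup>2 * \<bar>w\<bar>))"
  unfolding L_eq'
  using GDERIV_DERIV_compose[OF signal_gderiv[of e w], of \<Phi>, OF \<Phi>_deriv[of "signal (fst (e, w)) (snd (e, w))"]]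
  by simp

lemmas gradient_L = gradient_eqI[OF L_gderiv]

text \<open>The gradient of \<open>signal\<close> vanishes only for e = 0: otherwise its second
  entry forces w = 0, where the first entry is 2 e.\<close>

lemma critical_point_L_iff: "critical_point L (e, w) \<longleftrightarrow> e = 0 \<or> signal e w = a"
  unfolding critical_point_iff_gradient[OF L_gderiv]
  by (auto simp: zero_prod_def \<psi>_eq_0_iff)

lemma global_minimum_L: "signal e w = a \<Longrightarrow> global_minimum L (e, w)"
  unfolding global_minimum_def critical_point_L_iff using \<Phi>_min by (auto simp: L_eq)

lemma not_global_minimum_L: "\<not> global_minimum L (0, w)"
proof
  assume "global_minimum L (0, w)"
  \<comment> \<open>The point (sqrt a, 0) has signal exactly a.\<close>
  then have "L (0, w) \<le> L (sqrt a, 0)" by (auto simp: global_minimum_def)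
  then show False using \<Phi>_less[of 0 a] a_pos by (simp add: L_eq) (simp add: signal_def)
qed

text \<open>Nearby signals are nonpositive, and \<Phi> decreases up to a > 0.\<close>

lemma local_minimum_L:
  assumes "w < - 1 / sqrt 2" shows "local_minimum L (0, w)"
  unfolding local_minimum_def critical_point_L_iff
proof (intro conjI)
  have "\<forall>\<^sub>F \<theta> in nhds (0::real, w). snd \<theta> < - 1 / sqrt 2"
    by (rule order_tendstoD(2)[OF tendsto_snd[OF filterlim_ident]]) (use assms in simp)
  then show "\<forall>\<^sub>F \<theta> in nhds (0, w). L (0, w) \<le> L \<theta>"
  proof eventually_elim
    case (elim \<theta>)
    then have "signal (fst \<theta>) (snd \<theta>) \<le> 0"
      using one_plus_mult_abs_le_0_iff[of "snd \<theta>"] by (simp add: signal_def mult_nonneg_nonpos)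
    then show ?case
      using \<Phi>_less[of "signal (fst \<theta>) (snd \<theta>)" 0] a_pos unfolding L_eq'
      by (cases "signal (fst \<theta>) (snd \<theta>) = 0") auto
  qed
qed simp

text \<open>Nearby signals lie between 0 and a, where \<Phi> decreases.\<close>

lemma local_maximum_L:
  assumes "w > - 1 / sqrt 2" shows "local_maximum L (0, w)"
  unfolding local_maximum_def critical_point_L_iff
proof (intro conjI)
  have "\<forall>\<^sub>F \<theta> in nhds (0::real, w). snd \<theta> > - 1 / sqrt 2"
    by (rule order_tendstoD(1)[OF tendsto_snd[OF filterlim_ident]]) (use assms in simp)
  moreover have "\<forall>\<^sub>F \<theta> in nhds (0, w). signal (fst \<theta>) (snd \<theta>) < a"
    by (rule order_tendstoD(2)[OF tendsto_signal[OF tendsto_fst[OF filterlim_ident]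
      tendsto_snd[OF filterlim_ident]]]) (use a_pos in simp)
  ultimately show "\<forall>\<^sub>F \<theta> in nhds (0, w). L \<theta> \<le> L (0, w)"
  proof eventually_elim
    case (elim \<theta>)
    then have "0 \<le> signal (fst \<theta>) (snd \<theta>)"
      using one_plus_mult_abs_ge_0_iff[of "snd \<theta>"] by (simp add: signal_def)
    then show ?case
      using \<Phi>_less[of 0 "signal (fst \<theta>) (snd \<theta>)"] elim(2) unfolding L_eq'
      by (cases "signal (fst \<theta>) (snd \<theta>) = 0") auto
  qed
qed simp

text \<open>The factor 1 + 2 w |w| changes sign at -1/sqrt 2, so the two diagonals through the
  point, s = 1 and s = -1, carry signals of opposite signs.\<close>

lemma saddle_point_L: "saddle_point L (0, - 1 / sqrt 2)"
  unfolding saddle_point_def critical_point_L_iff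
proof (intro conjI allI impI)
  let ?c = "- 1 / sqrt 2 :: real"
  fix U :: "(real \<times> real) set"
  assume U: "open U \<and> (0, ?c) \<in> U"
  have lim: "((\<lambda>\<delta>. (\<delta>, ?c + s * \<delta>)) \<longlongrightarrow> (0, ?c)) (at_right 0)" for s
  proof -
    have "((\<lambda>\<delta>. (\<delta>, ?c + s * \<delta>)) \<longlongrightarrow> (0, ?c + s * 0)) (at_right 0)"
      by (intro tendsto_intros)
    then show ?thesis by simp
  qed
  have inU: "\<forall>\<^sub>F \<delta> in at_right 0. (\<delta>, ?c + s * \<delta>) \<in> U" for s
    using topological_tendstoD[OF lim] U by blast
  have small: "\<forall>\<^sub>F \<delta> in at_right 0. signal \<delta> (?c + s * \<delta>) < a" for s
    using order_tendstoD(2)[OF tendsto_signal[OF tendsto_fst[OF lim[of s]] tendsto_snd[OF lim[of s]]], of a]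
      a_pos by simp
  have pos: "\<forall>\<^sub>F \<delta> in at_right (0::real). 0 < \<delta>"
    by (simp add: eventually_at_right_less)
  obtain \<delta> where \<delta>: "0 < \<delta>" "(\<delta>, ?c + 1 * \<delta>) \<in> U" "signal \<delta> (?c + 1 * \<delta>) < a" "(\<delta>, ?c + (- 1) * \<delta>) \<in> U"
    using eventually_happens[OF eventually_conj[OF pos eventually_conj[OF inU[of 1]
      eventually_conj[OF small[of 1] inU[of "- 1"]]]]] by auto
  have "signal \<delta> (?c + \<delta>) > 0"
    using one_plus_mult_abs_le_0_iff[of "?c + \<delta>"] \<delta>(1) by (simp add: signal_def)
  then have "L (\<delta>, ?c + 1 * \<delta>) < L (0, ?c)"
    using \<Phi>_less[of 0 "signal \<delta> (?c + \<delta>)"] \<delta>(3) by (simp add: L_eq)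
  moreover have "signal \<delta> (?c - \<delta>) < 0"
    using one_plus_mult_abs_ge_0_iff[of "?c - \<delta>"] \<delta>(1) by (simp add: signal_def mult_pos_neg)
  then have "L (0, ?c) < L (\<delta>, ?c + (- 1) * \<delta>)"
    using \<Phi>_less[of "signal \<delta> (?c - \<delta>)" 0] a_pos by (simp add: L_eq)
  ultimately show "\<exists>y\<in>U. \<exists>z\<in>U. L y < L (0, ?c) \<and> L (0, ?c) < L z"
    using \<delta> by blast
qed simp

section \<open>Existence and limits of gradient trajectories\<close>

lemma flow_components:
  assumes "(\<theta> has_vector_derivative (u, v)) (at t within S)"
  shows "((\<lambda>t. fst (\<theta> t)) has_real_derivative u) (at t within S)"
    and "((\<lambda>t. snd (\<theta> t)) has_real_derivative v) (at t within S)"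
  using bounded_linear.has_vector_derivative[OF bounded_linear_fst assms]
    bounded_linear.has_vector_derivative[OF bounded_linear_snd assms]
  by (simp_all add: has_real_derivative_iff_has_vector_derivative)

text \<open>The factor \<kappa> is 1 for the true flow and a cut-off for the truncated one; being
  nonnegative, it preserves the sign pattern of \<psi>.\<close>

lemma rescaled_flow_if:
  fixes \<theta> :: "real \<Rightarrow> real \<times> real"
  defines "G \<equiv> \<lambda>t. \<psi> (signal (fst (\<theta> t)) (snd (\<theta> t)))"
  assumes flow: "\<And>t. t \<ge> 0 \<Longrightarrow> (\<theta> has_vector_derivative \<kappa> t *\<^sub>R (- gradient L (\<theta> t))) (at t within {0..})"
    and \<kappa>: "continuous_on {0..} \<kappa>" "\<And>t. t \<ge> 0 \<Longrightarrow> 0 \<le> \<kappa> t"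
  shows "rescaled_flow (\<lambda>t. fst (\<theta> t)) (\<lambda>t. snd (\<theta> t)) (\<lambda>t. \<kappa> t * G t) a"
proof
  have grad: "\<kappa> t *\<^sub>R (- gradient L (\<theta> t)) =
      (2 * (\<kappa> t * G t) * fst (\<theta> t) * (1 + 2 * snd (\<theta> t) * \<bar>snd (\<theta> t)\<bar>),
       4 * (\<kappa> t * G t) * (fst (\<theta> t))\<^sup>2 * \<bar>snd (\<theta> t)\<bar>)" for t
    using gradient_L[of "fst (\<theta> t)" "snd (\<theta> t)"] by (simp add: G_def)
  fix t :: real assume t: "t \<ge> 0"
  note * = flow[OF t, unfolded grad]
  show "((\<lambda>t. fst (\<theta> t)) has_real_derivative 2 * (\<kappa> t * G t) * fst (\<theta> t) *
      (1 + 2 * snd (\<theta> t) * \<bar>snd (\<theta> t)\<bar>)) (at t within {0..})"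
    by (rule flow_components(1)[OF *])
  show "((\<lambda>t. snd (\<theta> t)) has_real_derivative 4 * (\<kappa> t * G t) * (fst (\<theta> t))\<^sup>2 *
      \<bar>snd (\<theta> t)\<bar>) (at t within {0..})"
    by (rule flow_components(2)[OF *])
  show "0 \<le> \<kappa> t * G t" if "signal (fst (\<theta> t)) (snd (\<theta> t)) \<le> a"
    using \<kappa>(2)[OF t] \<psi>_pos[of "signal (fst (\<theta> t)) (snd (\<theta> t))"] \<psi>_a that
    by (cases "signal (fst (\<theta> t)) (snd (\<theta> t)) = a") (auto simp: G_def)
  show "\<kappa> t * G t \<le> 0" if "a \<le> signal (fst (\<theta> t)) (snd (\<theta> t))"
    using \<kappa>(2)[OF t] \<psi>_neg[of "signal (fst (\<theta> t)) (snd (\<theta> t))"] \<psi>_a that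
    by (cases "signal (fst (\<theta> t)) (snd (\<theta> t)) = a") (auto simp: G_def mult_nonneg_nonpos)
next
  have "continuous_on {0..} \<theta>"
    unfolding continuous_on_eq_continuous_within
    using flow by (blast intro: has_vector_derivative_continuous atLeast_iff[THEN iffD1])
  then show "continuous_on {0..} (\<lambda>t. \<kappa> t * G t)"
    unfolding G_def signal_def
    by (intro continuous_intros \<kappa> continuous_on_compose2[OF cont_\<psi>[of UNIV]]) auto
qed (rule a_pos)

lemma gradient_flow_exists: "\<exists>\<theta>. gradient_flow L \<theta>0 \<theta>"
proof -
  define R where "R = (fst \<theta>0)\<^sup>2 + \<bar>snd \<theta>0\<bar> + 2 * a + 1"
  \<comment> \<open>\<open>T\<close> clamps the coordinates so that every factor of the field is
    bounded Lipschitz. It is inactive wherever the cut-off \<kappa> is nonzero, that is for |e| +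
    |w| < 2 R + 1, and \<kappa> = 1 for |e| + |w| <= 2 R.\<close>
  define T where "T x = max (- (2 * R + 1)) (min (2 * R + 1) x)" for x :: real
  define \<kappa> where "\<kappa> \<theta> = max 0 (min 1 (2 * R + 1 - \<bar>fst \<theta>\<bar> - \<bar>snd \<theta>\<bar>))" for \<theta> :: "real \<times> real"
  define f where "f \<theta> = (let e = T (fst \<theta>); w = T (snd \<theta>); s = \<kappa> \<theta> * \<psi> (e * e * (1 + 2 * (w * \<bar>w\<bar>)))
    in (s * (2 * (e * (1 + 2 * (w * \<bar>w\<bar>)))), s * (4 * (e * e * \<bar>w\<bar>))))" for \<theta>
  have Te: "bounded_lipschitz (\<lambda>\<theta>::real \<times> real. T (fst \<theta>))" and Tw: "bounded_lipschitz (\<lambda>\<theta>::real \<times> real. T (snd \<theta>))"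
    unfolding T_def using bounded_lipschitz_truncate lipschitz_on_fst lipschitz_on_snd by blast+
  have "((0 + 1 * 1) + 1 * 1)-lipschitz_on UNIV (\<lambda>\<theta>::real \<times> real. 2 * R + 1 - \<bar>fst \<theta>\<bar> - \<bar>snd \<theta>\<bar>)"
    by (intro lipschitz_on_diff lipschitz_on_constant lipschitz_on_compose2[where g = abs]
      lipschitz_on_fst lipschitz_on_snd lipschitz_on_subset[OF lipschitz_on_abs]) auto
  then have \<kappa>: "bounded_lipschitz \<kappa>"
    unfolding \<kappa>_def[abs_def] by (rule bounded_lipschitz_truncate)
  have s: "bounded_lipschitz (\<lambda>\<theta>. \<kappa> \<theta> * \<psi> (T (fst \<theta>) * T (fst \<theta>) * (1 + 2 * (T (snd \<theta>) * \<bar>T (snd \<theta>)\<bar>))))"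
    by (intro bounded_lipschitz_mult bounded_lipschitz_add bounded_lipschitz_const \<kappa> Te Tw
      bounded_lipschitz_compose[OF \<psi>_lip] bounded_lipschitz_compose[OF lipschitz_on_abs])
  have "bounded_lipschitz (\<lambda>\<theta>. fst (f \<theta>))" "bounded_lipschitz (\<lambda>\<theta>. snd (f \<theta>))"
    unfolding f_def Let_def fst_conv snd_conv
    by (intro bounded_lipschitz_mult[OF s] bounded_lipschitz_mult bounded_lipschitz_add
      bounded_lipschitz_const Te Tw bounded_lipschitz_compose[OF lipschitz_on_abs])+
  then obtain K K' B B' where K: "K-lipschitz_on UNIV (\<lambda>\<theta>. fst (f \<theta>))" "K'-lipschitz_on UNIV (\<lambda>\<theta>. snd (f \<theta>))"
    and B: "\<And>\<theta>. \<bar>fst (f \<theta>)\<bar> \<le> B" "\<And>\<theta>. \<bar>snd (f \<theta>)\<bar> \<le> B'"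
    unfolding bounded_lipschitz_def by blast
  have "(sqrt (K\<^sup>2 + K'\<^sup>2))-lipschitz_on UNIV f"
    using lipschitz_on_Pair[OF K] by simp
  moreover have "norm (f \<theta>) \<le> B + B'" for \<theta>
    using norm_Pair_le[of "fst (f \<theta>)" "snd (f \<theta>)"] B[of \<theta>] by simp
  ultimately obtain \<theta> where \<theta>0: "\<theta> 0 = \<theta>0"
    and \<theta>: "\<And>t. t \<ge> 0 \<Longrightarrow> (\<theta> has_vector_derivative f (\<theta> t)) (at t within {0..})"
    using bounded_lipschitz_field_has_flow by blast
  have f: "f \<eta> = \<kappa> \<eta> *\<^sub>R (- gradient L \<eta>)" for \<eta>
  proof (cases "\<kappa> \<eta> = 0")
    case False
    then have "T (fst \<eta>) = fst \<eta>" "T (snd \<eta>) = snd \<eta>"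
      by (auto simp: \<kappa>_def T_def max_def min_def split: if_splits)
    then show ?thesis
      using gradient_L[of "fst \<eta>" "snd \<eta>"]
      by (simp add: f_def Let_def signal_def power2_eq_square mult.assoc)
  qed (simp add: f_def zero_prod_def)
  have cont\<theta>: "continuous_on {0..} \<theta>"
    unfolding continuous_on_eq_continuous_within
    using \<theta> by (blast intro: has_vector_derivative_continuous atLeast_iff[THEN iffD1])
  interpret flow: rescaled_flow "\<lambda>t. fst (\<theta> t)" "\<lambda>t. snd (\<theta> t)"
    "\<lambda>t. \<kappa> (\<theta> t) * \<psi> (signal (fst (\<theta> t)) (snd (\<theta> t)))" a
  proof (rule rescaled_flow_if)
    show "(\<theta> has_vector_derivative \<kappa> (\<theta> t) *\<^sub>R (- gradient L (\<theta> t))) (at t within {0..})" if "t \<ge> 0" for t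
      using \<theta>[OF that] by (simp add: f)
    show "continuous_on {0..} (\<lambda>t. \<kappa> (\<theta> t))"
      unfolding \<kappa>_def using cont\<theta> by (intro continuous_intros)
  qed (simp add: \<kappa>_def)
  \<comment> \<open>Each coordinate of the truncated orbit stays within R, so the cut-off is never
    felt.\<close>
  have "\<kappa> (\<theta> t) = 1" if "t \<ge> 0" for t
    using flow.abs_e_bounded[OF that] flow.abs_w_bounded[OF that]
    by (simp add: \<kappa>_def flow.R_def R_def \<theta>0)
  then have der: "(\<theta> has_vector_derivative - gradient L (\<theta> t)) (at t within {0..})" if "t \<ge> 0" for t
    using \<theta>[OF that] that by (simp add: f)
  have "continuous_on {0..} (\<lambda>t. gradient L (fst (\<theta> t), snd (\<theta> t)))"
    unfolding gradient_L signal_def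
    by (intro continuous_intros cont\<theta> continuous_on_compose2[OF cont_\<psi>[of UNIV]]) auto
  then have "gradient_flow L \<theta>0 \<theta>"
    unfolding gradient_flow_def using \<theta>0 der by simp
  then show ?thesis by blast
qed

text \<open>Failure of global minimality is recorded for all three exceptional regions, so that the
  event of reaching a global minimum can be identified exactly.\<close>

lemma gradient_flow_limit:
  assumes "gradient_flow L \<theta>0 \<theta>"
  shows "\<exists>\<theta>lim. (\<theta> \<longlongrightarrow> \<theta>lim) at_top \<and> critical_point L \<theta>lim \<and>
        (\<theta>0 \<in> I_min \<longrightarrow> local_minimum L \<theta>lim \<and> \<not> global_minimum L \<theta>lim) \<and>
        (\<theta>0 \<in> I_sad \<longrightarrow> saddle_point L \<theta>lim \<and> \<not> global_minimum L \<theta>lim) \<and>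
        (\<theta>0 \<in> I_max \<longrightarrow> local_maximum L \<theta>lim \<and> \<not> global_minimum L \<theta>lim) \<and>
        (\<theta>0 \<in> UNIV - (I_min \<union> I_sad \<union> I_max) \<longrightarrow> global_minimum L \<theta>lim)"
proof -
  define e where "e t = fst (\<theta> t)" for t
  define w where "w t = snd (\<theta> t)" for t
  have \<theta>0: "(e 0, w 0) = \<theta>0" and \<theta>: "\<theta> = (\<lambda>t. (e t, w t))"
    using assms by (auto simp: e_def w_def gradient_flow_def)
  have "rescaled_flow (\<lambda>t. fst (\<theta> t)) (\<lambda>t. snd (\<theta> t)) (\<lambda>t. 1 * \<psi> (signal (fst (\<theta> t)) (snd (\<theta> t)))) a"
    using assms by (intro rescaled_flow_if) (auto simp: gradient_flow_def)
  then interpret rescaled_flow e w "\<lambda>t. \<psi> (signal (e t) (w t))" a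
    by (simp add: e_def[abs_def] w_def[abs_def])
  obtain el wl where el: "(e \<longlongrightarrow> el) at_top" and wl: "(w \<longlongrightarrow> wl) at_top"
    using converges by blast
  have \<psi>lim: "((\<lambda>t. \<psi> (signal (e t) (w t))) \<longlongrightarrow> \<psi> (signal el wl)) at_top"
    using cont_\<psi>[of UNIV] tendsto_signal[OF el wl]
    by (auto simp: continuous_on_eq_continuous_at intro: isCont_tendsto_compose)
  \<comment> \<open>The velocity converges together with the orbit, so its limit is 0.\<close>
  have "2 * \<psi> (signal el wl) * el * (1 + 2 * wl * \<bar>wl\<bar>) = 0"
    by (rule derivative_limit_zero[OF e_deriv el]) (auto intro!: tendsto_intros \<psi>lim el wl)
  moreover have "4 * \<psi> (signal el wl) * el\<^sup>2 * \<bar>wl\<bar> = 0"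
    by (rule derivative_limit_zero[OF w_deriv wl]) (auto intro!: tendsto_intros \<psi>lim el wl)
  ultimately have crit: "el = 0 \<or> signal el wl = a"
    by (auto simp: \<psi>_eq_0_iff)
  have lim: "(\<theta> \<longlongrightarrow> (el, wl)) at_top"
    unfolding \<theta> by (intro tendsto_Pair el wl)
  show ?thesis
  proof (intro exI[of _ "(el, wl)"] conjI impI lim)
    show "critical_point L (el, wl)" using crit critical_point_L_iff by blast
  next
    assume "\<theta>0 \<in> I_min"
    then show "local_minimum L (el, wl)" "\<not> global_minimum L (el, wl)"
      using limit_I_min[OF el wl crit] \<theta>0 local_minimum_L not_global_minimum_L by auto
  next
    assume "\<theta>0 \<in> I_sad"
    then show "saddle_point L (el, wl)" "\<not> global_minimum L (el, wl)"
      using limit_I_sad[OF el wl crit] \<theta>0 saddle_point_L not_global_minimum_L by auto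
  next
    assume "\<theta>0 \<in> I_max"
    then show "local_maximum L (el, wl)" "\<not> global_minimum L (el, wl)"
      using limit_I_max[OF el wl crit] \<theta>0 local_maximum_L not_global_minimum_L by auto
  next
    assume "\<theta>0 \<in> UNIV - (I_min \<union> I_sad \<union> I_max)"
    then show "global_minimum L (el, wl)"
      using limit_generic[OF el wl crit] \<theta>0 global_minimum_L by auto
  qed
qed

text \<open>An equality of events rather than an inclusion: it shows the event to be Borel, whereas
  \<open>measure\<close> of a non-measurable set would default to 0.\<close>

lemma reaches_global_minimum_iff:
  "(\<exists>\<theta> \<theta>lim. gradient_flow L \<theta>0 \<theta> \<and> (\<theta> \<longlongrightarrow> \<theta>lim) at_top \<and> global_minimum L \<theta>lim)
    \<longleftrightarrow> \<theta>0 \<notin> I_min \<union> I_sad \<union> I_max"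
proof
  assume "\<exists>\<theta> \<theta>lim. gradient_flow L \<theta>0 \<theta> \<and> (\<theta> \<longlongrightarrow> \<theta>lim) at_top \<and> global_minimum L \<theta>lim"
  then obtain \<theta> \<theta>lim where *: "gradient_flow L \<theta>0 \<theta>" "(\<theta> \<longlongrightarrow> \<theta>lim) at_top" "global_minimum L \<theta>lim"
    by blast
  obtain l where l: "(\<theta> \<longlongrightarrow> l) at_top" "\<theta>0 \<in> I_min \<union> I_sad \<union> I_max \<longrightarrow> \<not> global_minimum L l"
    using gradient_flow_limit[OF *(1)] by blast
  have "l = \<theta>lim" using tendsto_unique[OF _ l(1) *(2)] by simp
  then show "\<theta>0 \<notin> I_min \<union> I_sad \<union> I_max" using l *(3) by blast
next
  assume "\<theta>0 \<notin> I_min \<union> I_sad \<union> I_max"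
  then show "\<exists>\<theta> \<theta>lim. gradient_flow L \<theta>0 \<theta> \<and> (\<theta> \<longlongrightarrow> \<theta>lim) at_top \<and> global_minimum L \<theta>lim"
    using gradient_flow_exists[of \<theta>0] gradient_flow_limit by blast
qed

end

section \<open>Gaussian initialization\<close>

text \<open>The line e = 0 is a null set, and w concentrates at 0; -1/2 is a convenient rational
  above the threshold -1/sqrt 2.\<close>

lemma prob_isotropic_normal_tendsto_1:
  assumes S: "S \<in> sets borel" and sub: "\<And>e w. e \<noteq> 0 \<Longrightarrow> - 1 / 2 < w \<Longrightarrow> (e, w) \<in> S"
  shows "((\<lambda>\<sigma>. measure (isotropic_normal \<sigma>) S) \<longlongrightarrow> 1) (at_right 0)"
proof (rule tendsto_sandwich)
  have bounds: "1 - 4 * \<sigma>\<^sup>2 \<le> measure (isotropic_normal \<sigma>) S \<and> measure (isotropic_normal \<sigma>) S \<le> 1"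
    if \<sigma>: "\<sigma> > 0" for \<sigma>
  proof -
    define \<nu> where "\<nu> = density lborel (normal_density 0 \<sigma>)"
    interpret \<nu>: prob_space \<nu>
      unfolding \<nu>_def using \<sigma> by (rule prob_space_normal_density)
    have [simp]: "space \<nu> = UNIV" and sets\<nu> [measurable_cong, simp]: "sets \<nu> = sets borel"
      by (simp_all add: \<nu>_def)
    interpret P: pair_prob_space \<nu> \<nu> ..
    have iso: "isotropic_normal \<sigma> = \<nu> \<Otimes>\<^sub>M \<nu>" by (simp add: isotropic_normal_def \<nu>_def)
    have setsP: "sets (\<nu> \<Otimes>\<^sub>M \<nu>) = sets borel"
      by (simp add: borel_prod[symmetric] cong: sets_pair_measure_cong)
    have D: "distributed \<nu> lborel (\<lambda>x. x) (normal_density 0 \<sigma>)"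
      unfolding distributed_def \<nu>_def by (auto simp: distr_id2)
    have sq: "integrable \<nu> (\<lambda>x. x\<^sup>2)"
      using integrable_normal_moment[OF \<sigma>, of 0 2] \<sigma>
      unfolding \<nu>_def by (subst integrable_density) (auto simp: mult.commute)
    \<comment> \<open>Chebyshev at distance 1/2 with variance \<sigma>^2 is the source of the bound
      4 \<sigma>^2.\<close>
    have "\<nu>.prob {x \<in> space \<nu>. 1 / 2 \<le> \<bar>x - \<nu>.expectation (\<lambda>x. x)\<bar>} \<le> \<nu>.variance (\<lambda>x. x) / (1 / 2)\<^sup>2"
      by (rule \<nu>.Chebyshev_inequality) (use sq in auto)
    then have cheb: "\<nu>.prob {x. 1 / 2 \<le> \<bar>x\<bar>} \<le> 4 * \<sigma>\<^sup>2"
      using \<nu>.normal_distributed_expectation[OF \<sigma> D] \<nu>.normal_distributed_variance[OF \<sigma> D]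
      by (simp add: power2_eq_square)
    have "\<nu>.prob {- 1 / 2<..} = 1 - \<nu>.prob {..- 1 / 2}"
      using \<nu>.prob_compl[of "{..- 1 / 2}"] by (simp add: Compl_eq_Diff_UNIV[symmetric])
    moreover have "\<nu>.prob {..- 1 / 2} \<le> \<nu>.prob {x. 1 / 2 \<le> \<bar>x\<bar>}"
      by (rule \<nu>.finite_measure_mono) auto
    ultimately have half: "1 - 4 * \<sigma>\<^sup>2 \<le> \<nu>.prob {- 1 / 2<..}" using cheb by linarith
    have "emeasure \<nu> {0} = 0"
      unfolding \<nu>_def by (subst emeasure_density) (auto simp: nn_integral_null_set)
    then have one: "\<nu>.prob (- {0}) = 1"
      using \<nu>.prob_compl[of "{0}"] by (simp add: Compl_eq_Diff_UNIV measure_def)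
    have "emeasure (\<nu> \<Otimes>\<^sub>M \<nu>) ((- {0}) \<times> {- 1 / 2<..}) = emeasure \<nu> (- {0}) * emeasure \<nu> {- 1 / 2<..}"
      by (rule \<nu>.emeasure_pair_measure_Times) auto
    then have "measure (\<nu> \<Otimes>\<^sub>M \<nu>) ((- {0}) \<times> {- 1 / 2<..}) = \<nu>.prob {- 1 / 2<..}"
      using one by (simp add: measure_def enn2real_mult)
    moreover have "measure (\<nu> \<Otimes>\<^sub>M \<nu>) ((- {0}) \<times> {- 1 / 2<..}) \<le> measure (\<nu> \<Otimes>\<^sub>M \<nu>) S"
      by (rule P.finite_measure_mono) (use sub S setsP in auto)
    ultimately show ?thesis using half iso P.prob_le_1 by simp
  qed
  show "\<forall>\<^sub>F \<sigma> in at_right 0. 1 - 4 * \<sigma>\<^sup>2 \<le> measure (isotropic_normal \<sigma>) S"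
    "\<forall>\<^sub>F \<sigma> in at_right 0. measure (isotropic_normal \<sigma>) S \<le> 1"
    using bounds by (auto simp: eventually_at_filter)
  have "((\<lambda>\<sigma>::real. 1 - 4 * \<sigma>\<^sup>2) \<longlongrightarrow> 1 - 4 * 0\<^sup>2) (at_right 0)"
    by (intro tendsto_intros)
  then show "((\<lambda>\<sigma>::real. 1 - 4 * \<sigma>\<^sup>2) \<longlongrightarrow> 1) (at_right 0)" by simp
qed simp

lemma I_regions_borel: "I_min \<in> sets borel" "I_sad \<in> sets borel" "I_max \<in> sets borel"
proof -
  have [measurable]: "g \<in> borel_measurable borel"
    unfolding g_def[abs_def] by measurable
  have eqs: "I_min = {\<theta> \<in> space (borel \<Otimes>\<^sub>M borel). snd \<theta> < - 1 / sqrt 2 \<and> - g (snd \<theta>) < fst \<theta> \<and> fst \<theta> < g (snd \<theta>)}"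
    "I_sad = {\<theta> \<in> space (borel \<Otimes>\<^sub>M borel). snd \<theta> \<le> - 1 / sqrt 2 \<and> (fst \<theta> = g (snd \<theta>) \<or> fst \<theta> = - g (snd \<theta>))}"
    "I_max = {\<theta> \<in> space (borel \<Otimes>\<^sub>M borel). fst \<theta> = 0 \<and> snd \<theta> > - 1 / sqrt 2}"
    by (auto simp: I_min_def I_sad_def I_max_def space_pair_measure)
  show "I_min \<in> sets borel" "I_sad \<in> sets borel" "I_max \<in> sets borel"
    unfolding eqs borel_prod[symmetric] by measurable
qed

theorem theorem8:
  fixes M :: "'w measure" and x :: "nat \<Rightarrow> 'w \<Rightarrow> nat" and p q :: real and N :: nat
  assumes "p \<in> {0<..<1}" and "q \<in> {0<..<1}" and "p + q < 1"
    and "N \<ge> 1"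
    and "binary_markov_chain M x p q"
  shows "(\<forall>\<theta>0. \<exists>\<theta>. gradient_flow (loss M x N) \<theta>0 \<theta>) \<and>
    (\<forall>\<theta>0 \<theta>. gradient_flow (loss M x N) \<theta>0 \<theta> \<longrightarrow>
      (\<exists>\<theta>lim. (\<theta> \<longlongrightarrow> \<theta>lim) at_top \<and> critical_point (loss M x N) \<theta>lim \<and>
        (\<theta>0 \<in> I_min \<longrightarrow>
          local_minimum (loss M x N) \<theta>lim \<and> \<not> global_minimum (loss M x N) \<theta>lim) \<and>
        (\<theta>0 \<in> I_sad \<longrightarrow> saddle_point (loss M x N) \<theta>lim) \<and>
        (\<theta>0 \<in> I_max \<longrightarrow> local_maximum (loss M x N) \<theta>lim) \<and>
        (\<theta>0 \<in> UNIV - (I_min \<union> I_sad \<union> I_max) \<longrightarrow> global_minimum (loss M x N) \<theta>lim))) \<and>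
    ((\<lambda>\<sigma>. \<P>(\<theta>0 in isotropic_normal \<sigma>.
        \<exists>\<theta> \<theta>lim. gradient_flow (loss M x N) \<theta>0 \<theta> \<and> (\<theta> \<longlongrightarrow> \<theta>lim) at_top \<and>
          global_minimum (loss M x N) \<theta>lim)) \<longlongrightarrow> 1) (at_right 0)"
proof -
  have pq: "transition_pair p q" using assms(1-3) by unfold_locales auto
  interpret chain: binary_markov_chain M x p q by fact
  interpret T: transition_pair p q by fact
  \<comment> \<open>\<Phi> is the loss minimised over the bias, \<psi> the drive and a the optimum;
    \<open>loss_eq\<close> links them to the chain.\<close>
  interpret signal_loss "loss M x N" T.min_loss T.drive T.optimum
    using chain.loss_eq[OF pq assms(4)] T.min_loss_deriv T.drive_strict_antimono T.drive_lipschitz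
      T.optimum_pos T.drive_optimum by unfold_locales auto
  have "((\<lambda>\<sigma>. measure (isotropic_normal \<sigma>) (- (I_min \<union> I_sad \<union> I_max))) \<longlongrightarrow> 1) (at_right 0)"
  proof (rule prob_isotropic_normal_tendsto_1)
    show "- (I_min \<union> I_sad \<union> I_max) \<in> sets borel"
      using I_regions_borel by (intro borel_comp sets.Un)
    show "(e, w) \<in> - (I_min \<union> I_sad \<union> I_max)" if "e \<noteq> 0" "- 1 / 2 < w" for e w
    proof -
      have "- 1 / sqrt 2 < w" using that(2) neg_inv_sqrt2_less(2) by linarith
      then show ?thesis using that(1) by (auto simp: I_min_def I_sad_def I_max_def)
    qed
  qed
  moreover have "{\<theta>0 \<in> space (isotropic_normal \<sigma>). \<exists>\<theta> \<theta>lim. gradient_flow (loss M x N) \<theta>0 \<theta> \<and>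
      (\<theta> \<longlongrightarrow> \<theta>lim) at_top \<and> global_minimum (loss M x N) \<theta>lim} = - (I_min \<union> I_sad \<union> I_max)" for \<sigma>
    unfolding reaches_global_minimum_iff
    by (auto simp: isotropic_normal_def space_pair_measure)
  ultimately have gauss: "((\<lambda>\<sigma>. \<P>(\<theta>0 in isotropic_normal \<sigma>.
        \<exists>\<theta> \<theta>lim. gradient_flow (loss M x N) \<theta>0 \<theta> \<and> (\<theta> \<longlongrightarrow> \<theta>lim) at_top \<and>
          global_minimum (loss M x N) \<theta>lim)) \<longlongrightarrow> 1) (at_right 0)"
    by simp
  show ?thesis
  proof (intro conjI allI impI)
    show "\<exists>\<theta>. gradient_flow (loss M x N) \<theta>0 \<theta>" for \<theta>0
      by (rule gradient_flow_exists)
  next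
    fix \<theta>0 \<theta> assume "gradient_flow (loss M x N) \<theta>0 \<theta>"
    from gradient_flow_limit[OF this] show "\<exists>\<theta>lim. (\<theta> \<longlongrightarrow> \<theta>lim) at_top \<and> critical_point (loss M x N) \<theta>lim \<and>
        (\<theta>0 \<in> I_min \<longrightarrow>
          local_minimum (loss M x N) \<theta>lim \<and> \<not> global_minimum (loss M x N) \<theta>lim) \<and>
        (\<theta>0 \<in> I_sad \<longrightarrow> saddle_point (loss M x N) \<theta>lim) \<and>
        (\<theta>0 \<in> I_max \<longrightarrow> local_maximum (loss M x N) \<theta>lim) \<and>
        (\<theta>0 \<in> UNIV - (I_min \<union> I_sad \<union> I_max) \<longrightarrow> global_minimum (loss M x N) \<theta>lim)"
      by blast
  qed (rule gauss)
qed

end
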